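(* Let $\rho:\mathbb{Z}^p\times\mathbb{R}^q\to\mathrm{Diff}[[\mathbb{C}^n,0]]$ be a homomorphism of Lie groups. Then there exists an abelian linear algebraic group $G$ over $\mathbb{C}$ (in particular an abelian Lie group with finitely many connected components) and a homomorphism of Lie groups $\rho^*:G\to\mathrm{Diff}[[\mathbb{C}^n,0]]$ such that $\operatorname{Im}\rho\subset\operatorname{Im}\rho^*$.
   Context: $\mathrm{Diff}[[\mathbb{C}^n,0]]$ is the group of $\mathbb{C}$-algebra automorphisms of $\mathbb{C}[[x_1,\dots,x_n]]$ preserving the maximal ideal $\mathfrak m$. A map from a Lie group into $\mathrm{Diff}[[\mathbb{C}^n,0]]$ is called a homomorphism of Lie groups if for every $p$ the induced map into the finite-dimensional group of automorphisms of $\mathbb{C}[[x]]/\mathfrak m^{p+1}$ is a homomorphism of Lie groups. *)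

theory Defs
  imports Complex_Main "Jordan_Normal_Form.Matrix"
begin

type_synonym 'n fps_n = "('n \<Rightarrow> nat) \<Rightarrow> complex"

definition fps_n_mult :: "'n::finite fps_n \<Rightarrow> 'n fps_n \<Rightarrow> 'n fps_n" where
  "fps_n_mult f g = (\<lambda>\<alpha>. \<Sum>\<beta>\<in>{\<beta>. \<forall>i. \<beta> i \<le> \<alpha> i}. f \<beta> * g (\<lambda>i. \<alpha> i - \<beta> i))"

definition fps_n_one :: "'n::finite fps_n" where
  "fps_n_one = (\<lambda>\<alpha>. if \<alpha> = (\<lambda>_. 0) then 1 else 0)"

definition fps_n_monom :: "('n::finite \<Rightarrow> nat) \<Rightarrow> 'n fps_n" where
  "fps_n_monom \<beta> = (\<lambda>\<gamma>. if \<gamma> = \<beta> then 1 else 0)"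

definition fps_n_max_ideal :: "'n::finite fps_n set" where
  "fps_n_max_ideal = {f. f (\<lambda>_. 0) = 0}"

definition formal_diff :: "('n::finite fps_n \<Rightarrow> 'n fps_n) set" where
  "formal_diff = {\<phi>. bij \<phi>
     \<and> (\<forall>f g. \<phi> (\<lambda>\<alpha>. f \<alpha> + g \<alpha>) = (\<lambda>\<alpha>. \<phi> f \<alpha> + \<phi> g \<alpha>))
     \<and> (\<forall>c f. \<phi> (\<lambda>\<alpha>. c * f \<alpha>) = (\<lambda>\<alpha>. c * \<phi> f \<alpha>))
     \<and> (\<forall>f g. \<phi> (fps_n_mult f g) = fps_n_mult (\<phi> f) (\<phi> g))
     \<and> \<phi> fps_n_one = fps_n_one
     \<and> \<phi> ` fps_n_max_ideal \<subseteq> fps_n_max_ideal}"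

text \<open>The p-jet of phi (induced automorphism of C[[x]]/m^(k+1)) is the linear map whose
  matrix entries are the coefficients of index alpha, |alpha| <= k, of phi(x^beta), |beta| <= k.\<close>
definition jet_entry :: "('n::finite fps_n \<Rightarrow> 'n fps_n) \<Rightarrow> ('n \<Rightarrow> nat) \<Rightarrow> ('n \<Rightarrow> nat) \<Rightarrow> complex" where
  "jet_entry \<phi> \<alpha> \<beta> = \<phi> (fps_n_monom \<beta>) \<alpha>"

definition ZR_dom :: "nat \<Rightarrow> nat \<Rightarrow> ((nat \<Rightarrow> int) \<times> (nat \<Rightarrow> real)) set" where
  "ZR_dom p q = {(a, b). (\<forall>i\<ge>p. a i = 0) \<and> (\<forall>j\<ge>q. b j = 0)}"

definition ZR_add :: "(nat \<Rightarrow> int) \<times> (nat \<Rightarrow> real) \<Rightarrow> (nat \<Rightarrow> int) \<times> (nat \<Rightarrow> real) \<Rightarrow> (nat \<Rightarrow> int) \<times> (nat \<Rightarrow> real)" where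
  "ZR_add x y = ((\<lambda>i. fst x i + fst y i), (\<lambda>j. snd x j + snd y j))"

definition ZR_continuous :: "nat \<Rightarrow> nat \<Rightarrow> ((nat \<Rightarrow> int) \<times> (nat \<Rightarrow> real) \<Rightarrow> complex) \<Rightarrow> bool" where
  "ZR_continuous p q F = (\<forall>x\<in>ZR_dom p q. \<forall>\<epsilon>>0. \<exists>\<delta>>0. \<forall>y\<in>ZR_dom p q.
     fst y = fst x \<and> (\<forall>j<q. \<bar>snd y j - snd x j\<bar> < \<delta>) \<longrightarrow> cmod (F y - F x) < \<epsilon>)"

definition lie_hom_ZR :: "nat \<Rightarrow> nat \<Rightarrow> ((nat \<Rightarrow> int) \<times> (nat \<Rightarrow> real) \<Rightarrow> ('n::finite fps_n \<Rightarrow> 'n fps_n)) \<Rightarrow> bool" where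
  "lie_hom_ZR p q \<rho> = (\<rho> ` ZR_dom p q \<subseteq> formal_diff
     \<and> (\<forall>x\<in>ZR_dom p q. \<forall>y\<in>ZR_dom p q. \<rho> (ZR_add x y) = \<rho> x \<circ> \<rho> y)
     \<and> (\<forall>k \<alpha> \<beta>. sum \<alpha> UNIV \<le> k \<and> sum \<beta> UNIV \<le> k \<longrightarrow>
          ZR_continuous p q (\<lambda>x. jet_entry (\<rho> x) \<alpha> \<beta>)))"

inductive_set polyfun :: "nat \<Rightarrow> (complex mat \<Rightarrow> complex) set" for N where
  const: "(\<lambda>A. c) \<in> polyfun N"
| entry: "i < N \<Longrightarrow> j < N \<Longrightarrow> (\<lambda>A. A $$ (i, j)) \<in> polyfun N"
| add: "P \<in> polyfun N \<Longrightarrow> Q \<in> polyfun N \<Longrightarrow> (\<lambda>A. P A + Q A) \<in> polyfun N"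
| mult: "P \<in> polyfun N \<Longrightarrow> Q \<in> polyfun N \<Longrightarrow> (\<lambda>A. P A * Q A) \<in> polyfun N"

definition abelian_linear_algebraic_group :: "nat \<Rightarrow> complex mat set \<Rightarrow> bool" where
  "abelian_linear_algebraic_group N G = (
     G \<subseteq> carrier_mat N N \<and> (\<forall>A\<in>G. invertible_mat A)
     \<and> 1\<^sub>m N \<in> G
     \<and> (\<forall>A\<in>G. \<forall>B\<in>G. A * B \<in> G)
     \<and> (\<forall>A\<in>G. \<exists>B\<in>G. A * B = 1\<^sub>m N)
     \<and> (\<forall>A\<in>G. \<forall>B\<in>G. A * B = B * A)
     \<and> (\<exists>S \<subseteq> polyfun N. G = {A \<in> carrier_mat N N. invertible_mat A \<and> (\<forall>P\<in>S. P A = 0)}))"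

definition mat_continuous_on :: "nat \<Rightarrow> complex mat set \<Rightarrow> (complex mat \<Rightarrow> complex) \<Rightarrow> bool" where
  "mat_continuous_on N G F = (\<forall>A\<in>G. \<forall>\<epsilon>>0. \<exists>\<delta>>0. \<forall>B\<in>G.
     (\<forall>i<N. \<forall>j<N. cmod (B $$ (i, j) - A $$ (i, j)) < \<delta>) \<longrightarrow> cmod (F B - F A) < \<epsilon>)"

definition lie_hom_mat :: "nat \<Rightarrow> complex mat set \<Rightarrow> (complex mat \<Rightarrow> ('n::finite fps_n \<Rightarrow> 'n fps_n)) \<Rightarrow> bool" where
  "lie_hom_mat N G \<rho> = (\<rho> ` G \<subseteq> formal_diff
     \<and> (\<forall>A\<in>G. \<forall>B\<in>G. \<rho> (A * B) = \<rho> A \<circ> \<rho> B)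
     \<and> (\<forall>k \<alpha> \<beta>. sum \<alpha> UNIV \<le> k \<and> sum \<beta> UNIV \<le> k \<longrightarrow>
          mat_continuous_on N G (\<lambda>A. jet_entry (\<rho> A) \<alpha> \<beta>)))"

end

theory Submission
  imports Defs "HOL-Library.Function_Algebras"
    "HOL-Computational_Algebra.Fundamental_Theorem_Algebra"
    "HOL-Computational_Algebra.Polynomial_Factorial" "HOL-Computational_Algebra.Field_as_Ring"
begin

text \<open>
  The group generated by the images of the generators of \<open>\<int>\<^sup>p\<close> and of the coordinate axes of
  \<open>\<real>\<^sup>q\<close> is enlarged factor by factor.  An axis is the image of the additive group \<open>\<complex>\<close> under the real
  part.  For a generator \<open>F\<close> of \<open>\<int>\<^sup>p\<close> one uses the Jordan decomposition.  Each jet space splits into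
  generalised eigenspaces of \<open>F\<close>, multiplication of power series multiplies eigenvalues, and so all
  eigenvalues lie in the multiplicative monoid \<open>E\<close> generated by the finitely many eigenvalues on
  1-jets.  Letting a character \<open>\<chi>\<close> of \<open>E\<close> act as \<open>\<chi>(\<mu>)\<close> on the \<open>\<mu>\<close>-part defines an action of a
  diagonalisable group by automorphisms.  The semisimple part of \<open>F\<close> is the character \<open>\<mu> \<mapsto> \<mu>\<close>; the
  unipotent part \<open>U\<close> lies on the one-parameter group \<open>U\<^sup>z\<close> given by the binomial series.  All these
  groups lie in the bicommutant of \<open>F\<close>, so those of different generators commute and their product,
  realised by block diagonal matrices, acts.
\<close>

section \<open>Power series and filtered operators\<close>

text \<open>As simplification rules these expand sums and differences of series even where no coefficient
  is taken.\<close>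

lemmas pointwise = plus_fun_apply zero_fun_apply minus_apply uminus_apply
declare pointwise [simp del]

lemma sum_fun_apply: "(\<Sum>i\<in>I. f i) x = (\<Sum>i\<in>I. f i x :: 'b::comm_monoid_add)"
  by (induction I rule: infinite_finite_induct) (auto simp: pointwise)

definition scale :: "complex \<Rightarrow> 'n fps_n \<Rightarrow> 'n fps_n" where
  "scale c f = (\<lambda>\<alpha>. c * f \<alpha>)"

lemma scale_apply: "scale c f \<alpha> = c * f \<alpha>"
  by (simp add: scale_def)

interpretation fps_n: vector_space scale
  by standard (auto simp: scale_def fun_eq_iff algebra_simps pointwise)

interpretation fps_n_op: vector_space_pair scale scale ..

abbreviation linear_op :: "('n fps_n \<Rightarrow> 'n fps_n) \<Rightarrow> bool" where
  "linear_op \<equiv> Vector_Spaces.linear scale scale"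

lemma linear_op_iff:
  "linear_op \<phi> \<longleftrightarrow> (\<forall>f g. \<phi> (f + g) = \<phi> f + \<phi> g) \<and> (\<forall>c f. \<phi> (scale c f) = scale c (\<phi> f))"
  by (auto simp: Vector_Spaces.linear_iff fps_n.vector_space_axioms)

definition mdeg :: "('n::finite \<Rightarrow> nat) \<Rightarrow> nat" where
  "mdeg \<alpha> = sum \<alpha> UNIV"

lemma mdeg_eq_0_iff: "mdeg \<alpha> = 0 \<longleftrightarrow> \<alpha> = (\<lambda>_. 0)"
  by (auto simp: mdeg_def)

lemma mdeg_upd_Suc: "mdeg (\<alpha>(i := Suc (\<alpha> i))) = Suc (mdeg \<alpha>)"
proof -
  have "sum (\<alpha>(i := Suc (\<alpha> i))) (UNIV - {i}) = sum \<alpha> (UNIV - {i})" by (rule sum.cong) auto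
  then show ?thesis by (simp add: mdeg_def sum.remove[of UNIV i])
qed

lemma finite_index_le: "finite {\<beta>::'n::finite \<Rightarrow> nat. \<forall>i. \<beta> i \<le> \<alpha> i}"
proof -
  have "{\<beta>::'n \<Rightarrow> nat. \<forall>i. \<beta> i \<le> \<alpha> i} = Pi\<^sub>E UNIV (\<lambda>i. {..\<alpha> i})"
    by (auto simp: PiE_def Pi_def)
  then show ?thesis by (simp add: finite_PiE)
qed

lemma index_le_mdeg: "\<beta> i \<le> mdeg \<beta>"
  unfolding mdeg_def by (rule member_le_sum) auto

lemma finite_mdeg_le: "finite {\<beta>::'n::finite \<Rightarrow> nat. mdeg \<beta> \<le> k}"
  by (rule finite_subset[OF _ finite_index_le[of "\<lambda>_. k"]])
     (auto intro: order_trans[OF index_le_mdeg])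

definition mpow :: "nat \<Rightarrow> 'n::finite fps_n set" where
  "mpow k = {f. \<forall>\<alpha>. mdeg \<alpha> < k \<longrightarrow> f \<alpha> = 0}"

lemma subspace_mpow: "fps_n.subspace (mpow k)"
  by (rule fps_n.subspaceI) (auto simp: mpow_def scale_def pointwise)

lemmas mpow_add = fps_n.subspace_add[OF subspace_mpow]
  and mpow_diff = fps_n.subspace_diff[OF subspace_mpow]
  and mpow_scale = fps_n.subspace_scale[OF subspace_mpow]
  and mpow_sum = fps_n.subspace_sum[OF subspace_mpow]
  and mpow_zero [simp] = fps_n.subspace_0[OF subspace_mpow]

lemma mpow_anti: "j \<le> k \<Longrightarrow> f \<in> mpow k \<Longrightarrow> f \<in> mpow j"
  by (auto simp: mpow_def)

lemma mpow_0 [simp]: "f \<in> mpow 0"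
  by (auto simp: mpow_def)

lemma mem_mpow_Suc_0_iff: "f \<in> mpow (Suc 0) \<longleftrightarrow> f (\<lambda>_. 0) = 0"
  using mdeg_eq_0_iff by (auto simp: mpow_def)

lemma fps_n_max_ideal_eq_mpow: "fps_n_max_ideal = mpow (Suc 0)"
  using mem_mpow_Suc_0_iff by (auto simp: fps_n_max_ideal_def)

lemma mpow_cong_trans: "f - g \<in> mpow k \<Longrightarrow> g - h \<in> mpow k \<Longrightarrow> f - h \<in> mpow k"
  using mpow_add[of "f - g" k "g - h"] by simp

lemma mpow_cong_common: "f - g \<in> mpow k \<Longrightarrow> h - g \<in> mpow k \<Longrightarrow> f - h \<in> mpow k"
  using mpow_diff[of "f - g" k "h - g"] by simp

lemma mpow_cong_mem: "f - g \<in> mpow k \<Longrightarrow> g \<in> mpow k \<Longrightarrow> f \<in> mpow k"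
  using mpow_add[of "f - g" k g] by simp

lemma fps_n_eqI_mpow:
  assumes "\<And>k. f - g \<in> mpow (Suc k)" shows "f = g"
proof
  fix \<alpha>
  from assms[of "mdeg \<alpha>"] show "f \<alpha> = g \<alpha>" by (auto simp: mpow_def pointwise)
qed

lemma fps_n_mult_add_left: "fps_n_mult (f + g) h = fps_n_mult f h + fps_n_mult g h"
  and fps_n_mult_add_right: "fps_n_mult h (f + g) = fps_n_mult h f + fps_n_mult h g"
  and fps_n_mult_scale_left: "fps_n_mult (scale c f) h = scale c (fps_n_mult f h)"
  and fps_n_mult_scale_right: "fps_n_mult h (scale c f) = scale c (fps_n_mult h f)"
  by (auto simp: fps_n_mult_def scale_def fun_eq_iff algebra_simps pointwise sum.distrib
      sum_distrib_left)

lemma linear_op_fps_n_mult_left: "linear_op (\<lambda>f. fps_n_mult f h)"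
  and linear_op_fps_n_mult_right: "linear_op (fps_n_mult h)"
  by (simp_all add: linear_op_iff fps_n_mult_add_left fps_n_mult_add_right fps_n_mult_scale_left
      fps_n_mult_scale_right)

lemmas fps_n_mult_diff_left = fps_n_op.linear_diff[OF linear_op_fps_n_mult_left]
  and fps_n_mult_diff_right = fps_n_op.linear_diff[OF linear_op_fps_n_mult_right]
  and fps_n_mult_sum_left = fps_n_op.linear_sum[OF linear_op_fps_n_mult_left]
  and fps_n_mult_sum_right = fps_n_op.linear_sum[OF linear_op_fps_n_mult_right]

lemma mpow_mult:
  assumes "f \<in> mpow a" "g \<in> mpow b"
  shows "fps_n_mult f g \<in> mpow (a + b)"
proof -
  have "f \<beta> * g (\<lambda>i. \<alpha> i - \<beta> i) = 0"
    if "mdeg \<alpha> < a + b" "\<forall>i. \<beta> i \<le> \<alpha> i" for \<alpha> \<beta>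
  proof -
    have "mdeg \<beta> + mdeg (\<lambda>i. \<alpha> i - \<beta> i) = mdeg \<alpha>"
      unfolding mdeg_def using that(2) by (simp flip: sum.distrib)
    then have "mdeg \<beta> < a \<or> mdeg (\<lambda>i. \<alpha> i - \<beta> i) < b"
      using that(1) by linarith
    then show ?thesis using assms by (auto simp: mpow_def)
  qed
  then show ?thesis unfolding mpow_def fps_n_mult_def by (auto intro!: sum.neutral)
qed

lemma mpow_mult_cong:
  assumes "f - f' \<in> mpow k" "g - g' \<in> mpow k"
  shows "fps_n_mult f g - fps_n_mult f' g' \<in> mpow k"
proof -
  have "fps_n_mult f g - fps_n_mult f' g' = fps_n_mult (f - f') g + fps_n_mult f' (g - g')"
    by (simp add: fps_n_mult_diff_left fps_n_mult_diff_right)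
  moreover have "fps_n_mult (f - f') g \<in> mpow k" "fps_n_mult f' (g - g') \<in> mpow k"
    using mpow_mult[of "f - f'" k g 0] mpow_mult[of f' 0 "g - g'" k] assms by auto
  ultimately show ?thesis by (simp add: mpow_add)
qed

definition fps_n_var :: "'n::finite \<Rightarrow> 'n fps_n" where
  "fps_n_var i = fps_n_monom (\<lambda>j. if j = i then 1 else 0)"

lemma fps_n_var_mult:
  "fps_n_mult (fps_n_var i) g \<alpha> = (if 0 < \<alpha> i then g (\<alpha>(i := \<alpha> i - 1)) else 0)"
proof -
  define e where "e = (\<lambda>j. if j = i then 1 else (0::nat))"
  have "fps_n_mult (fps_n_var i) g \<alpha> =
      (\<Sum>\<beta>\<in>{\<beta>. \<forall>i. \<beta> i \<le> \<alpha> i}. if \<beta> = e then g (\<lambda>i. \<alpha> i - e i) else 0)"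
    unfolding fps_n_mult_def fps_n_var_def fps_n_monom_def e_def
    by (rule sum.cong) auto
  also have "\<dots> = (if \<forall>j. e j \<le> \<alpha> j then g (\<lambda>i. \<alpha> i - e i) else 0)"
    using finite_index_le[of \<alpha>] by (simp add: sum.delta)
  also have "(\<forall>j. e j \<le> \<alpha> j) = (0 < \<alpha> i)" by (auto simp: e_def Suc_le_eq)
  also have "(\<lambda>i. \<alpha> i - e i) = \<alpha>(i := \<alpha> i - 1)" by (auto simp: e_def)
  finally show ?thesis .
qed

lemma fps_n_var_mpow: "fps_n_var i \<in> mpow (Suc 0)"
  by (auto simp: mem_mpow_Suc_0_iff fps_n_var_def fps_n_monom_def dest: fun_cong[of _ _ i])

text \<open>Each monomial of \<open>f\<close> is assigned to one of the variables that it contains.\<close>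

lemma mpow_Suc_decompose:
  fixes f :: "'n::finite fps_n"
  assumes "f \<in> mpow (Suc k)"
  obtains g where "\<And>i. g i \<in> mpow k" "f = (\<Sum>i\<in>UNIV. fps_n_mult (fps_n_var i) (g i))"
proof -
  have "\<exists>i. \<alpha> = (\<lambda>_. 0) \<or> 0 < \<alpha> i" for \<alpha> :: "'n \<Rightarrow> nat" by auto
  then obtain v :: "('n \<Rightarrow> nat) \<Rightarrow> 'n" where v: "\<alpha> = (\<lambda>_. 0) \<or> 0 < \<alpha> (v \<alpha>)" for \<alpha>
    by metis
  define g where "g = (\<lambda>i \<alpha>. if v (\<alpha>(i := Suc (\<alpha> i))) = i then f (\<alpha>(i := Suc (\<alpha> i))) else 0)"
  have "g i \<in> mpow k" for i
    using assms mdeg_upd_Suc[of _ i] by (auto simp: mpow_def g_def)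
  moreover have "f = (\<Sum>i\<in>UNIV. fps_n_mult (fps_n_var i) (g i))"
  proof
    fix \<alpha> :: "'n \<Rightarrow> nat"
    have "(\<Sum>i\<in>UNIV. fps_n_mult (fps_n_var i) (g i)) \<alpha> =
        (\<Sum>i\<in>UNIV. if v \<alpha> = i then (if 0 < \<alpha> i then f \<alpha> else 0) else 0)"
      unfolding sum_fun_apply fps_n_var_mult by (rule sum.cong) (auto simp: g_def)
    also have "\<dots> = (if 0 < \<alpha> (v \<alpha>) then f \<alpha> else 0)" by (simp add: sum.delta)
    also have "\<dots> = f \<alpha>"
      using v[of \<alpha>] assms mpow_anti[of "Suc 0" "Suc k" f] by (auto simp: mem_mpow_Suc_0_iff)
    finally show "f \<alpha> = (\<Sum>i\<in>UNIV. fps_n_mult (fps_n_var i) (g i)) \<alpha>" ..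
  qed
  ultimately show ?thesis using that by blast
qed

definition jet_truncation :: "nat \<Rightarrow> 'n::finite fps_n \<Rightarrow> 'n fps_n" where
  "jet_truncation k f = (\<Sum>\<beta> | mdeg \<beta> \<le> k. scale (f \<beta>) (fps_n_monom \<beta>))"

lemma linear_op_jet_truncation: "linear_op (jet_truncation k)"
  by (simp add: linear_op_iff jet_truncation_def pointwise scale_apply fps_n.scale_left_distrib
      sum.distrib fps_n.scale_sum_right)

lemma jet_truncation_cong: "f - jet_truncation k f \<in> mpow (Suc k)"
proof -
  have "jet_truncation k f \<alpha> = f \<alpha>" if "mdeg \<alpha> \<le> k" for \<alpha>
  proof -
    have "jet_truncation k f \<alpha> = (\<Sum>\<beta> | mdeg \<beta> \<le> k. if \<beta> = \<alpha> then f \<beta> else 0)"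
      unfolding jet_truncation_def sum_fun_apply
      by (rule sum.cong) (auto simp: fps_n_monom_def scale_apply)
    then show ?thesis using that by (simp add: sum.delta finite_mdeg_le)
  qed
  then show ?thesis by (simp add: mpow_def pointwise)
qed

definition filtered :: "('n::finite fps_n \<Rightarrow> 'n fps_n) \<Rightarrow> bool" where
  "filtered \<phi> \<longleftrightarrow> linear_op \<phi> \<and> (\<forall>k. \<forall>f\<in>mpow k. \<phi> f \<in> mpow k)"

lemma filtered_linear: "filtered \<phi> \<Longrightarrow> linear_op \<phi>"
  and filtered_mpow: "filtered \<phi> \<Longrightarrow> f \<in> mpow k \<Longrightarrow> \<phi> f \<in> mpow k"
  by (auto simp: filtered_def)

lemmas filtered_map_add = fps_n_op.linear_add[OF filtered_linear]
  and filtered_map_diff = fps_n_op.linear_diff[OF filtered_linear]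
  and filtered_map_scale = fps_n_op.linear_scale[OF filtered_linear]
  and filtered_map_sum = fps_n_op.linear_sum[OF filtered_linear]

lemma filtered_cong: "filtered \<phi> \<Longrightarrow> f - g \<in> mpow k \<Longrightarrow> \<phi> f - \<phi> g \<in> mpow k"
  using filtered_mpow[of \<phi> "f - g" k] by (simp add: filtered_map_diff)

lemma filtered_id: "filtered id" "filtered (\<lambda>f. f)"
  by (auto simp: filtered_def linear_op_iff)

lemma filtered_comp: "filtered \<phi> \<Longrightarrow> filtered \<psi> \<Longrightarrow> filtered (\<phi> \<circ> \<psi>)"
  by (auto simp: filtered_def linear_op_iff)

lemma filtered_scale: "filtered \<phi> \<Longrightarrow> filtered (\<lambda>f. scale c (\<phi> f))"
  unfolding filtered_def by (auto intro: fps_n_op.linear_compose_scale_right mpow_scale)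

lemma filtered_diff: "filtered \<phi> \<Longrightarrow> filtered \<psi> \<Longrightarrow> filtered (\<lambda>f. \<phi> f - \<psi> f)"
  unfolding filtered_def by (auto intro: fps_n_op.linear_compose_sub mpow_diff)

lemma filtered_sum: "(\<And>i. i \<in> I \<Longrightarrow> filtered (\<phi> i)) \<Longrightarrow> filtered (\<lambda>f. \<Sum>i\<in>I. \<phi> i f)"
  unfolding filtered_def by (auto intro: fps_n_op.linear_compose_sum mpow_sum)

lemma filtered_funpow: "filtered \<phi> \<Longrightarrow> filtered (\<phi> ^^ j)"
  by (induction j) (auto intro: filtered_id filtered_comp)

lemma filtered_apply_eq:
  assumes "filtered \<phi>"
  shows "\<phi> f \<alpha> = (\<Sum>\<beta> | mdeg \<beta> \<le> mdeg \<alpha>. f \<beta> * jet_entry \<phi> \<alpha> \<beta>)"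
proof -
  have "\<phi> f - \<phi> (jet_truncation (mdeg \<alpha>) f) \<in> mpow (Suc (mdeg \<alpha>))"
    by (rule filtered_cong[OF assms jet_truncation_cong])
  then have "\<phi> f \<alpha> = \<phi> (jet_truncation (mdeg \<alpha>) f) \<alpha>"
    by (auto simp: mpow_def pointwise)
  then show ?thesis
    by (simp add: jet_truncation_def filtered_map_sum[OF assms] filtered_map_scale[OF assms]
        sum_fun_apply scale_apply jet_entry_def)
qed

lemma jet_entry_comp:
  assumes "filtered \<phi>"
  shows "jet_entry (\<phi> \<circ> \<psi>) \<alpha> \<beta> = (\<Sum>\<gamma> | mdeg \<gamma> \<le> mdeg \<alpha>. jet_entry \<psi> \<gamma> \<beta> * jet_entry \<phi> \<alpha> \<gamma>)"
  using filtered_apply_eq[OF assms, of "\<psi> (fps_n_monom \<beta>)" \<alpha>] by (simp add: jet_entry_def)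

section \<open>Formal diffeomorphisms\<close>

lemma formal_diff_iff:
  "\<phi> \<in> formal_diff \<longleftrightarrow> bij \<phi> \<and> linear_op \<phi> \<and> (\<forall>f g. \<phi> (fps_n_mult f g) = fps_n_mult (\<phi> f) (\<phi> g))
     \<and> \<phi> fps_n_one = fps_n_one \<and> (\<forall>f\<in>mpow (Suc 0). \<phi> f \<in> mpow (Suc 0))"
  unfolding formal_diff_def linear_op_iff scale_def plus_fun_def fps_n_max_ideal_eq_mpow by auto

lemma formal_diff_bij: "\<phi> \<in> formal_diff \<Longrightarrow> bij \<phi>"
  and formal_diff_mult: "\<phi> \<in> formal_diff \<Longrightarrow> \<phi> (fps_n_mult f g) = fps_n_mult (\<phi> f) (\<phi> g)"
  and formal_diff_one: "\<phi> \<in> formal_diff \<Longrightarrow> \<phi> fps_n_one = fps_n_one"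
  by (auto simp: formal_diff_iff)

lemma formal_diff_filtered:
  assumes "\<phi> \<in> formal_diff" shows "filtered \<phi>"
proof -
  have lin: "linear_op \<phi>" using assms by (simp add: formal_diff_iff)
  have "\<forall>f\<in>mpow k. \<phi> f \<in> mpow k" for k
  proof (induction k)
    case (Suc k)
    show ?case
    proof
      fix f :: "'a fps_n" assume "f \<in> mpow (Suc k)"
      then obtain g where g: "\<And>i. g i \<in> mpow k" "f = (\<Sum>i\<in>UNIV. fps_n_mult (fps_n_var i) (g i))"
        by (rule mpow_Suc_decompose) blast
      have "\<phi> f = (\<Sum>i\<in>UNIV. fps_n_mult (\<phi> (fps_n_var i)) (\<phi> (g i)))"
        by (simp add: g(2) fps_n_op.linear_sum[OF lin] formal_diff_mult[OF assms])
      moreover have "fps_n_mult (\<phi> (fps_n_var i)) (\<phi> (g i)) \<in> mpow (Suc k)" for i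
        using mpow_mult[of "\<phi> (fps_n_var i)" "Suc 0" "\<phi> (g i)" k] assms Suc.IH g(1)
          fps_n_var_mpow[of i]
        by (simp add: formal_diff_iff)
      ultimately show "\<phi> f \<in> mpow (Suc k)" by (simp add: mpow_sum)
    qed
  qed auto
  with lin show ?thesis by (auto simp: filtered_def)
qed

lemma formal_diffI:
  assumes "filtered \<phi>" "bij \<phi>" "\<And>f g. \<phi> (fps_n_mult f g) = fps_n_mult (\<phi> f) (\<phi> g)"
    and "\<phi> fps_n_one = fps_n_one"
  shows "\<phi> \<in> formal_diff"
  using assms by (auto simp: formal_diff_iff filtered_def)

lemma formal_diff_id: "id \<in> formal_diff"
  by (rule formal_diffI) (auto intro: filtered_id)

lemma formal_diff_comp: "\<phi> \<in> formal_diff \<Longrightarrow> \<psi> \<in> formal_diff \<Longrightarrow> \<phi> \<circ> \<psi> \<in> formal_diff"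
  by (rule formal_diffI)
    (auto intro: filtered_comp formal_diff_filtered bij_comp simp: formal_diff_bij formal_diff_mult
      formal_diff_one)

lemma formal_diff_constant_coeff:
  assumes "\<phi> \<in> formal_diff" shows "\<phi> f (\<lambda>_. 0) = f (\<lambda>_. 0)"
proof -
  let ?c = "scale (f (\<lambda>_. 0)) fps_n_one"
  note filt = formal_diff_filtered[OF assms]
  have "f - ?c \<in> mpow (Suc 0)" by (simp add: mem_mpow_Suc_0_iff scale_apply fps_n_one_def pointwise)
  then have "\<phi> f - ?c \<in> mpow (Suc 0)"
    using filtered_cong[OF filt, of f ?c "Suc 0"] formal_diff_one[OF assms]
    by (simp add: filtered_map_scale[OF filt])
  then show ?thesis by (simp add: mem_mpow_Suc_0_iff scale_apply fps_n_one_def pointwise)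
qed

lemma formal_diff_inverse:
  assumes "\<phi> \<in> formal_diff"
  obtains \<psi> where "\<psi> \<in> formal_diff" "\<phi> \<circ> \<psi> = id" "\<psi> \<circ> \<phi> = id"
proof -
  obtain \<psi> where \<psi>: "\<phi> \<circ> \<psi> = id" "\<psi> \<circ> \<phi> = id"
    using formal_diff_bij[OF assms] unfolding bij_iff by (metis comp_apply eq_id_iff)
  have right: "\<phi> (\<psi> f) = f" for f using \<psi>(1) by (metis comp_apply id_apply)
  have eqI: "\<psi> g = f" if "\<phi> f = g" for f g using \<psi>(2) that by (metis comp_apply id_apply)
  note lin = filtered_linear[OF formal_diff_filtered[OF assms]]
  have "\<psi> \<in> formal_diff"
    unfolding formal_diff_iff
  proof (intro conjI allI ballI)
    show "bij \<psi>" by (rule o_bij[OF \<psi>])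
    show "linear_op \<psi>"
      unfolding linear_op_iff
      by (intro conjI allI eqI)
        (simp_all add: fps_n_op.linear_add[OF lin] fps_n_op.linear_scale[OF lin] right)
    show "\<psi> (fps_n_mult f g) = fps_n_mult (\<psi> f) (\<psi> g)" for f g
      by (intro eqI) (simp add: formal_diff_mult[OF assms] right)
    show "\<psi> fps_n_one = fps_n_one" by (intro eqI formal_diff_one[OF assms])
    show "\<psi> f \<in> mpow (Suc 0)" if "f \<in> mpow (Suc 0)" for f
      using that formal_diff_constant_coeff[OF assms, of "\<psi> f"]
      by (simp add: mem_mpow_Suc_0_iff right)
  qed
  with \<psi> show ?thesis by (intro that)
qed

lemma formal_diff_reflects_mpow:
  assumes "\<phi> \<in> formal_diff" "\<phi> f \<in> mpow k" shows "f \<in> mpow k"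
proof -
  obtain \<psi> where "\<psi> \<in> formal_diff" "\<psi> \<circ> \<phi> = id" using formal_diff_inverse[OF assms(1)] .
  then show ?thesis
    using filtered_mpow[OF formal_diff_filtered assms(2)] by (metis comp_apply id_apply)
qed

section \<open>Polynomials of an operator\<close>

abbreviation roots :: "'a::comm_semiring_0 poly \<Rightarrow> 'a set" where
  "roots P \<equiv> {\<mu>. poly P \<mu> = 0}"

lemma Gcd_image_linear_combination:
  fixes f :: "'b \<Rightarrow> 'a::{euclidean_ring_gcd, semiring_Gcd}"
  assumes "finite A"
  shows "\<exists>b. (\<Sum>x\<in>A. b x * f x) = Gcd (f ` A)"
  using assms
proof (induction A)
  case (insert x A)
  then obtain b where b: "(\<Sum>y\<in>A. b y * f y) = Gcd (f ` A)" by blast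
  obtain s t where st: "s * f x + t * Gcd (f ` A) = gcd (f x) (Gcd (f ` A))"
    using bezout_coefficients_fst_snd by blast
  define b' where "b' = (\<lambda>y. if y = x then s else t * b y)"
  have "(\<Sum>y\<in>A. b' y * f y) = t * (\<Sum>y\<in>A. b y * f y)"
    unfolding sum_distrib_left using insert.hyps by (intro sum.cong) (auto simp: b'_def mult.assoc)
  then have "(\<Sum>y\<in>insert x A. b' y * f y) = Gcd (f ` insert x A)"
    using insert.hyps by (simp add: b b'_def flip: st)
  then show ?case by blast
qed auto

lemma coprime_linear_powers:
  fixes \<mu> \<nu> :: "'a::{alg_closed_field, field_gcd}"
  assumes "\<mu> \<noteq> \<nu>" shows "coprime ([:- \<mu>, 1:] ^ r) ([:- \<nu>, 1:] ^ s)"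
proof -
  have "coprime [:- \<mu>, 1:] [:- \<nu>, 1:]"
  proof (rule coprimeI)
    fix d assume "d dvd [:- \<mu>, 1:]" and "d dvd [:- \<nu>, 1:]"
    then have "d dvd [:- \<nu>, 1:] - [:- \<mu>, 1:]" by (intro dvd_diff)
    also have "[:- \<nu>, 1:] - [:- \<mu>, 1:] = [:\<mu> - \<nu>:]" by simp
    finally show "is_unit d" using assms is_unit_triv[of "\<mu> - \<nu>"] dvd_unit_imp_unit by simp blast
  qed
  then show ?thesis by simp
qed

text \<open>The cofactors of \<open>Q\<close> with respect to its primary factors have no common root.\<close>

lemma partial_fractions:
  fixes Q :: "'a::{alg_closed_field, field_gcd} poly"
  assumes "degree Q > 0"
  shows "\<exists>e. (\<Sum>\<mu>\<in>roots Q. e \<mu>) = 1 \<and> (\<forall>\<mu>\<in>roots Q. Q dvd [:- \<mu>, 1:] ^ degree Q * e \<mu>)"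
proof -
  have "Q \<noteq> 0" using assms by auto
  have "\<exists>P. Q = [:- \<mu>, 1:] ^ order \<mu> Q * P \<and> poly P \<mu> \<noteq> 0" for \<mu>
    using order_decomp[OF \<open>Q \<noteq> 0\<close>, of \<mu>] by (auto simp: poly_eq_0_iff_dvd)
  then obtain P where P: "Q = [:- \<mu>, 1:] ^ order \<mu> Q * P \<mu>" "poly (P \<mu>) \<mu> \<noteq> 0" for \<mu>
    by metis
  have finite: "finite (roots Q)" using \<open>Q \<noteq> 0\<close> by (rule poly_roots_finite)
  obtain \<mu> where \<mu>: "poly Q \<mu> = 0" using alg_closed_imp_poly_has_root[OF assms] ..
  have "is_unit (Gcd (P ` roots Q))"
  proof (rule ccontr)
    assume "\<not> is_unit (Gcd (P ` roots Q))"
    moreover have "Gcd (P ` roots Q) \<noteq> 0" using \<mu> P(2)[of \<mu>] by (auto simp: Gcd_0_iff)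
    ultimately obtain \<nu> where "poly (Gcd (P ` roots Q)) \<nu> = 0"
      using alg_closed_imp_poly_has_root is_unit_iff_degree by blast
    then have \<nu>: "poly (P \<kappa>) \<nu> = 0" if "poly Q \<kappa> = 0" for \<kappa>
      using that Gcd_dvd[of "P \<kappa>" "P ` roots Q"] by (auto elim!: dvdE)
    have "poly Q \<nu> = 0" using \<nu>[OF \<mu>] by (subst P(1)[of \<mu>]) simp
    then show False using \<nu> P(2) by blast
  qed
  then have "Gcd (P ` roots Q) = 1" by (metis is_unit_normalize normalize_Gcd)
  then obtain b where b: "(\<Sum>\<mu>\<in>roots Q. b \<mu> * P \<mu>) = 1"
    using Gcd_image_linear_combination[OF finite, of P] by auto
  moreover have "Q dvd [:- \<mu>, 1:] ^ degree Q * (b \<mu> * P \<mu>)" for \<mu>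
  proof -
    have "[:- \<mu>, 1:] ^ order \<mu> Q * P \<mu> dvd [:- \<mu>, 1:] ^ degree Q * (b \<mu> * P \<mu>)"
      using order_degree[OF \<open>Q \<noteq> 0\<close>] by (intro mult_dvd_mono le_imp_power_dvd) auto
    then show ?thesis using P(1) by metis
  qed
  ultimately show ?thesis by blast
qed

definition partial_fraction :: "'a::{alg_closed_field, field_gcd} poly \<Rightarrow> 'a \<Rightarrow> 'a poly" where
  "partial_fraction Q = (SOME e. (\<Sum>\<mu>\<in>roots Q. e \<mu>) = 1 \<and>
     (\<forall>\<mu>\<in>roots Q. Q dvd [:- \<mu>, 1:] ^ degree Q * e \<mu>))"

lemma sum_partial_fraction: "degree Q > 0 \<Longrightarrow> (\<Sum>\<mu>\<in>roots Q. partial_fraction Q \<mu>) = 1"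
  and dvd_partial_fraction:
    "degree Q > 0 \<Longrightarrow> poly Q \<mu> = 0 \<Longrightarrow> Q dvd [:- \<mu>, 1:] ^ degree Q * partial_fraction Q \<mu>"
  using someI_ex[OF partial_fractions[of Q]] unfolding partial_fraction_def by auto

definition poly_op :: "('n fps_n \<Rightarrow> 'n fps_n) \<Rightarrow> complex poly \<Rightarrow> 'n fps_n \<Rightarrow> 'n fps_n" where
  "poly_op F P f = (\<Sum>i\<le>degree P. scale (coeff P i) ((F ^^ i) f))"

lemma poly_op_eq_sum:
  "degree P \<le> n \<Longrightarrow> poly_op F P f = (\<Sum>i\<le>n. scale (coeff P i) ((F ^^ i) f))"
  unfolding poly_op_def by (rule sum.mono_neutral_left) (auto simp: coeff_eq_0)

lemma poly_op_0 [simp]: "poly_op F 0 f = 0"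
  by (simp add: poly_op_def)

lemma poly_op_1 [simp]: "poly_op F 1 f = f"
  by (simp add: poly_op_def)

lemma poly_op_pCons:
  assumes "linear_op F"
  shows "poly_op F (pCons a P) f = scale a f + F (poly_op F P f)"
proof -
  have "poly_op F (pCons a P) f = (\<Sum>i\<le>Suc (degree P). scale (coeff (pCons a P) i) ((F ^^ i) f))"
    by (rule poly_op_eq_sum) (simp add: degree_pCons_le)
  also have "\<dots> = scale a f + (\<Sum>i\<le>degree P. scale (coeff P i) ((F ^^ Suc i) f))"
    by (simp add: sum.atMost_Suc_shift del: sum.atMost_Suc)
  also have "(\<Sum>i\<le>degree P. scale (coeff P i) ((F ^^ Suc i) f)) = F (poly_op F P f)"
    unfolding poly_op_def
    by (simp add: fps_n_op.linear_sum[OF assms] fps_n_op.linear_scale[OF assms])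
  finally show ?thesis .
qed

lemma poly_op_add: "poly_op F (P + Q) f = poly_op F P f + poly_op F Q f"
proof -
  define n where "n = max (degree P) (degree Q)"
  have "degree (P + Q) \<le> n" "degree P \<le> n" "degree Q \<le> n"
    unfolding n_def by (auto intro: degree_add_le)
  then show ?thesis
    by (simp add: poly_op_eq_sum[of _ n] fps_n.scale_left_distrib sum.distrib)
qed

lemma poly_op_smult: "poly_op F (smult c P) f = scale c (poly_op F P f)"
  by (simp add: poly_op_eq_sum[of _ "degree P"] degree_smult_le fps_n.scale_sum_right)

lemma poly_op_diff: "poly_op F (P - Q) f = poly_op F P f - poly_op F Q f"
  using poly_op_add[of F P "smult (- 1) Q" f] poly_op_smult[of F "- 1" Q f] by simp

lemma poly_op_sum: "poly_op F (\<Sum>i\<in>I. P i) f = (\<Sum>i\<in>I. poly_op F (P i) f)"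
  by (induction I rule: infinite_finite_induct) (auto simp: poly_op_add)

lemma poly_op_mult:
  assumes "linear_op F"
  shows "poly_op F (P * Q) f = poly_op F P (poly_op F Q f)"
  by (induction P) (simp_all add: poly_op_add poly_op_smult poly_op_pCons[OF assms])

lemma poly_op_commute: "linear_op F \<Longrightarrow> poly_op F P (poly_op F Q f) = poly_op F Q (poly_op F P f)"
  by (metis poly_op_mult mult.commute)

lemma poly_op_X: "linear_op F \<Longrightarrow> poly_op F [:0, 1:] f = F f"
  by (simp add: poly_op_pCons fps_n_op.linear_0)

lemma poly_op_linear_factor: "linear_op F \<Longrightarrow> poly_op F [:- \<mu>, 1:] f = F f - scale \<mu> f"
  by (simp add: poly_op_pCons fps_n_op.linear_0)

lemma poly_op_monom: "linear_op F \<Longrightarrow> poly_op F (monom c j) f = scale c ((F ^^ j) f)"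
  by (induction j)
    (simp_all add: monom_0 monom_Suc poly_op_pCons fps_n_op.linear_0 fps_n_op.linear_scale)

lemma poly_op_intertwine:
  assumes "linear_op \<psi>" "\<psi> \<circ> F = F \<circ> \<psi>"
  shows "\<psi> (poly_op F P f) = poly_op F P (\<psi> f)"
proof -
  have "\<psi> (F g) = F (\<psi> g)" for g using assms(2) by (metis comp_apply)
  then have "\<psi> ((F ^^ i) f) = (F ^^ i) (\<psi> f)" for i by (induction i) auto
  then show ?thesis
    unfolding poly_op_def
    by (simp add: fps_n_op.linear_sum[OF assms(1)] fps_n_op.linear_scale[OF assms(1)])
qed

lemma linear_op_poly_op:
  assumes "linear_op F" shows "linear_op (poly_op F P)"
proof (induction P)
  case 0
  then show ?case by (simp add: linear_op_iff)
next
  case (pCons a P)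
  then show ?case
    using assms
    by (simp add: linear_op_iff poly_op_pCons[OF assms] fps_n.scale_right_distrib mult.commute)
qed

lemma filtered_poly_op: "filtered F \<Longrightarrow> filtered (poly_op F P)"
  unfolding poly_op_def by (intro filtered_sum filtered_scale filtered_funpow)

lemmas poly_op_mpow = filtered_mpow[OF filtered_poly_op]

lemma poly_op_dvd_mpow:
  assumes "filtered F" "P dvd Q" "poly_op F P f \<in> mpow k"
  shows "poly_op F Q f \<in> mpow k"
proof -
  obtain R where "Q = R * P" using assms(2) by (metis dvdE mult.commute)
  then show ?thesis using assms by (simp add: poly_op_mult filtered_linear poly_op_mpow)
qed

lemma poly_op_coprime_mpow:
  assumes "filtered F" "coprime P Q" "poly_op F P f \<in> mpow k" "poly_op F Q f \<in> mpow k"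
  shows "f \<in> mpow k"
proof -
  obtain a b where ab: "a * P + b * Q = 1"
    using bezout_coefficients_fst_snd[of P Q] assms(2) by (auto simp: coprime_iff_gcd_eq_1)
  have "f = poly_op F (a * P + b * Q) f" unfolding ab by simp
  also have "\<dots> = poly_op F a (poly_op F P f) + poly_op F b (poly_op F Q f)"
    using filtered_linear[OF assms(1)] by (simp only: poly_op_add poly_op_mult)
  also have "\<dots> \<in> mpow k" using assms by (simp add: mpow_add poly_op_mpow)
  finally show ?thesis .
qed

lemma sum_poly_op_partial_fraction:
  "degree Q > 0 \<Longrightarrow> (\<Sum>\<mu>\<in>roots Q. poly_op F (partial_fraction Q \<mu>) f) = f"
  by (simp add: sum_partial_fraction flip: poly_op_sum)

lemma poly_op_partial_fraction_mpow:
  assumes "filtered F" "degree Q > 0" "poly Q \<mu> = 0" "poly_op F Q f \<in> mpow k"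
  shows "poly_op F ([:- \<mu>, 1:] ^ degree Q) (poly_op F (partial_fraction Q \<mu>) f) \<in> mpow k"
  using poly_op_dvd_mpow[OF assms(1) dvd_partial_fraction[OF assms(2,3)] assms(4)]
  by (simp only: poly_op_mult[OF filtered_linear[OF assms(1)]])

lemma poly_op_linear_factor_mult:
  assumes "linear_op F" "\<And>f g. F (fps_n_mult f g) = fps_n_mult (F f) (F g)"
  shows "poly_op F [:- (\<mu> * \<nu>), 1:] (fps_n_mult g h) =
    fps_n_mult (poly_op F [:- \<mu>, 1:] g) (F h) + scale \<mu> (fps_n_mult g (poly_op F [:- \<nu>, 1:] h))"
  by (simp only: poly_op_linear_factor[OF assms(1)])
    (simp add: assms(2) fps_n_mult_diff_left fps_n_mult_diff_right fps_n_mult_scale_left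
      fps_n_mult_scale_right fps_n.scale_right_diff_distrib)

lemma poly_op_linear_factor_power_Suc_mult:
  assumes "linear_op F" "\<And>f g. F (fps_n_mult f g) = fps_n_mult (F f) (F g)"
  shows "poly_op F ([:- (\<mu> * \<nu>), 1:] ^ Suc n) (fps_n_mult g h) =
    poly_op F ([:- (\<mu> * \<nu>), 1:] ^ n) (fps_n_mult (poly_op F [:- \<mu>, 1:] g) (F h)) +
    scale \<mu> (poly_op F ([:- (\<mu> * \<nu>), 1:] ^ n) (fps_n_mult g (poly_op F [:- \<nu>, 1:] h)))"
  by (simp only: power_Suc2 poly_op_mult[OF assms(1)] poly_op_linear_factor_mult[OF assms]
      fps_n_op.linear_add[OF linear_op_poly_op] fps_n_op.linear_scale[OF linear_op_poly_op]
      assms(1))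

lemma poly_op_power_mult_mpow:
  assumes filt: "filtered F" and mult: "\<And>f g. F (fps_n_mult f g) = fps_n_mult (F f) (F g)"
    and "g \<in> mpow a" "h \<in> mpow b"
    and "poly_op F ([:- \<mu>, 1:] ^ r) g \<in> mpow (a + c)" "poly_op F ([:- \<nu>, 1:] ^ s) h \<in> mpow (b + c)"
  shows "poly_op F ([:- (\<mu> * \<nu>), 1:] ^ (r + s)) (fps_n_mult g h) \<in> mpow (a + b + c)"
  using assms(3-)
proof (induction "r + s" arbitrary: r s g h rule: less_induct)
  case less
  note lin = filtered_linear[OF filt]
  let ?L = "\<lambda>\<mu>. [:- \<mu>, 1:] :: complex poly"
  consider (zero) "r = 0 \<or> s = 0" | (Suc) r' s' where "r = Suc r'" "s = Suc s'"
    by (metis not0_implies_Suc)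
  then show ?case
  proof cases
    case zero
    then have "fps_n_mult g h \<in> mpow (a + b + c)"
      using mpow_mult[of g "a + c" h b] mpow_mult[of g a h "b + c"] less.prems
        by (auto simp: add_ac)
    then show ?thesis by (rule poly_op_mpow[OF filt])
  next
    case Suc
    have "poly_op F (?L (\<mu> * \<nu>) ^ (r' + s)) (fps_n_mult (poly_op F (?L \<mu>) g) (F h))
        \<in> mpow (a + b + c)"
    proof (rule less.hyps)
      show "poly_op F (?L \<mu> ^ r') (poly_op F (?L \<mu>) g) \<in> mpow (a + c)"
        using less.prems(3) by (simp only: Suc power_Suc2 poly_op_mult[OF lin])
      have "poly_op F (?L \<nu> ^ s) (F h) = F (poly_op F (?L \<nu> ^ s) h)"
        using poly_op_commute[OF lin, of _ "[:0, 1:]"] by (simp only: poly_op_X[OF lin])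
      then show "poly_op F (?L \<nu> ^ s) (F h) \<in> mpow (b + c)"
        using filtered_mpow[OF filt less.prems(4)] by (simp only:)
    qed (use Suc less.prems poly_op_mpow[OF filt] filtered_mpow[OF filt] in auto)
    moreover have "poly_op F (?L (\<mu> * \<nu>) ^ (r + s')) (fps_n_mult g (poly_op F (?L \<nu>) h))
        \<in> mpow (a + b + c)"
    proof (rule less.hyps)
      show "poly_op F (?L \<nu> ^ s') (poly_op F (?L \<nu>) h) \<in> mpow (b + c)"
        using less.prems(4) by (simp only: Suc power_Suc2 poly_op_mult[OF lin])
    qed (use Suc less.prems poly_op_mpow[OF filt] in auto)
    moreover have "r' + s = r + s'" "r + s = Suc (r + s')" by (simp_all add: Suc)
    ultimately show ?thesis
      by (simp only: poly_op_linear_factor_power_Suc_mult[OF lin mult] mpow_add mpow_scale)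
  qed
qed

lemma span_image_lessThan:
  "x \<in> fps_n.span (w ` {..<n::nat}) \<Longrightarrow> \<exists>c. x = (\<Sum>j<n. scale (c j) (w j))"
proof (induction n arbitrary: x)
  case (Suc n)
  then obtain k where "x - scale k (w n) \<in> fps_n.span (w ` {..<n})"
    by (auto simp: lessThan_Suc fps_n.span_breakdown_eq)
  then obtain c where c: "x - scale k (w n) = (\<Sum>j<n. scale (c j) (w j))" using Suc.IH by blast
  have "x = (\<Sum>j<n. scale (c j) (w j)) + scale k (w n)" unfolding c[symmetric] by simp
  then have "x = (\<Sum>j<Suc n. scale ((c(n := k)) j) (w j))" by simp
  then show ?case by blast
qed simp

text \<open>Among the vectors \<open>L (F\<^sup>j v)\<close>, the first one in the span of its predecessors gives a monic
  polynomial.\<close>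

lemma exists_poly_op_kernel:
  assumes F: "linear_op F" and L: "linear_op L" and T: "finite T" "\<And>f. L f \<in> fps_n.span T"
  obtains P where "P \<noteq> 0" "L (poly_op F P v) = 0"
proof -
  define w where "w = (\<lambda>j. L ((F ^^ j) v))"
  have "\<exists>n. w n \<in> fps_n.span (w ` {..<n})"
  proof (rule ccontr)
    assume none: "\<nexists>n. w n \<in> fps_n.span (w ` {..<n})"
    have "fps_n.independent (w ` {..<n}) \<and> card (w ` {..<n}) = n" for n
    proof (induction n)
      case (Suc n)
      have "w n \<notin> w ` {..<n}" using none fps_n.span_base[of "w n"] by metis
      with Suc none show ?case by (simp add: lessThan_Suc fps_n.independent_insert)
    qed (simp add: fps_n.independent_empty)
    moreover have "card (w ` {..<n}) \<le> card T" if "fps_n.independent (w ` {..<n})" for n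
    proof -
      have "w ` {..<n} \<subseteq> fps_n.span T" unfolding w_def using T(2) by blast
      then show ?thesis using fps_n.independent_span_bound[OF T(1) that] by blast
    qed
    ultimately show False by (metis Suc_n_not_le_n)
  qed
  then obtain n c where n: "w n = (\<Sum>j<n. scale (c j) (w j))" using span_image_lessThan by blast
  define P where "P = monom 1 n - (\<Sum>j<n. monom (c j) j)"
  show ?thesis
  proof
    have "coeff P n = 1" by (simp add: P_def coeff_sum)
    then show "P \<noteq> 0" by auto
    have "L (poly_op F P v) = w n - (\<Sum>j<n. scale (c j) (w j))"
      by (simp add: P_def poly_op_diff poly_op_sum poly_op_monom[OF F] w_def
          fps_n_op.linear_diff[OF L] fps_n_op.linear_sum[OF L] fps_n_op.linear_scale[OF L])
    then show "L (poly_op F P v) = 0" by (simp add: n)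
  qed
qed

definition annihilates_jets :: "('n::finite fps_n \<Rightarrow> 'n fps_n) \<Rightarrow> complex poly \<Rightarrow> nat \<Rightarrow> bool" where
  "annihilates_jets F P k \<longleftrightarrow> P \<noteq> 0 \<and> (\<forall>f. poly_op F P f \<in> mpow k)"

lemma annihilates_jets_degree_pos:
  fixes F :: "'n::finite fps_n \<Rightarrow> 'n fps_n"
  assumes "annihilates_jets F P (Suc k)" shows "degree P > 0"
proof (rule ccontr)
  assume "\<not> degree P > 0"
  then obtain c where "P = [:c:]" by (metis degree_eq_zeroE neq0_conv)
  then have "c \<noteq> 0" "scale c (fps_n_one :: 'n fps_n) \<in> mpow (Suc k)"
    using assms by (auto simp: annihilates_jets_def poly_op_def)
  moreover from this have "scale c (fps_n_one :: 'n fps_n) (\<lambda>_. 0) = 0"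
    using mpow_anti[of "Suc 0" "Suc k"] by (simp flip: mem_mpow_Suc_0_iff)
  ultimately show False by (simp add: scale_apply fps_n_one_def)
qed

lemma exists_annihilates_jets:
  fixes F :: "'n::finite fps_n \<Rightarrow> 'n fps_n"
  assumes filt: "filtered F"
  shows "\<exists>P. annihilates_jets F P (Suc k)"
proof -
  define M :: "('n \<Rightarrow> nat) set" where "M = {\<beta>. mdeg \<beta> \<le> k}"
  have M: "finite M" unfolding M_def by (rule finite_mdeg_le)
  have "\<exists>P. P \<noteq> 0 \<and> poly_op F P v \<in> mpow (Suc k)" for v
  proof -
    have "jet_truncation k f \<in> fps_n.span (fps_n_monom ` M)" for f
      unfolding jet_truncation_def M_def
      by (intro fps_n.span_sum fps_n.span_scale fps_n.span_base) auto
    then obtain P where "P \<noteq> 0" "jet_truncation k (poly_op F P v) = 0"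
      using exists_poly_op_kernel[OF filtered_linear[OF filt] linear_op_jet_truncation] M by blast
    then show ?thesis using jet_truncation_cong[of "poly_op F P v" k] by auto
  qed
  then obtain P where P: "P v \<noteq> 0" "poly_op F (P v) v \<in> mpow (Suc k)" for v by metis
  define Q where "Q = (\<Prod>\<beta>\<in>M. P (fps_n_monom \<beta>))"
  have filtQ: "filtered (poly_op F Q)" by (rule filtered_poly_op[OF filt])
  have "poly_op F Q (fps_n_monom \<beta>) \<in> mpow (Suc k)" if "\<beta> \<in> M" for \<beta>
    unfolding Q_def by (rule poly_op_dvd_mpow[OF filt dvd_prodI[OF M that] P(2)])
  then have "poly_op F Q (jet_truncation k f) \<in> mpow (Suc k)" for f
    unfolding jet_truncation_def filtered_map_sum[OF filtQ] filtered_map_scale[OF filtQ]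
    by (intro mpow_sum mpow_scale) (simp add: M_def)
  then have "poly_op F Q f \<in> mpow (Suc k)" for f
    using filtered_cong[OF filtQ jet_truncation_cong] mpow_cong_mem by blast
  moreover have "Q \<noteq> 0" using M P(1) by (simp add: Q_def)
  ultimately show ?thesis unfolding annihilates_jets_def by blast
qed

lemma formal_diff_annihilates_jets:
  assumes F: "F \<in> formal_diff"
  shows "\<exists>P. annihilates_jets F P (Suc k) \<and> 0 \<notin> roots P"
proof -
  note lin = filtered_linear[OF formal_diff_filtered[OF F]]
  obtain Q where Q: "Q \<noteq> 0" "\<And>f. poly_op F Q f \<in> mpow (Suc k)"
    using exists_annihilates_jets[OF formal_diff_filtered[OF F]]
    unfolding annihilates_jets_def by blast
  obtain P where P: "Q = [:0, 1:] ^ order 0 Q * P" "\<not> [:0, 1:] dvd P"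
    using order_decomp[OF Q(1), of 0] by auto
  have cancel: "f \<in> mpow (Suc k)" if "(F ^^ j) f \<in> mpow (Suc k)" for f j
    using that by (induction j) (auto dest: formal_diff_reflects_mpow[OF F])
  have "poly_op F P f \<in> mpow (Suc k)" for f
  proof -
    have "poly_op F Q f = (F ^^ order 0 Q) (poly_op F P f)"
      by (subst P(1))
        (simp add: poly_op_mult[OF lin] poly_op_monom[OF lin] flip: monom_altdef[of 1, simplified])
    then show ?thesis using Q(2) cancel by metis
  qed
  moreover have "poly P 0 \<noteq> 0" using P(2) poly_eq_0_iff_dvd[of P 0] by simp
  ultimately show ?thesis unfolding annihilates_jets_def by (intro exI[of _ P]) auto
qed

section \<open>Spectral decomposition of a formal diffeomorphism\<close>

definition root_products :: "complex poly \<Rightarrow> complex poly \<Rightarrow> complex poly" where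
  "root_products P Q = (\<Prod>(\<mu>, \<nu>)\<in>roots P \<times> roots Q. [:- (\<mu> * \<nu>), 1:] ^ (degree P + degree Q))"

lemma root_products_nonzero: "root_products P Q \<noteq> 0"
  unfolding root_products_def by (cases "finite (roots P \<times> roots Q)") auto

lemma roots_root_products: "roots (root_products P Q) \<subseteq> {\<mu> * \<nu> | \<mu> \<nu>. \<mu> \<in> roots P \<and> \<nu> \<in> roots Q}"
proof (cases "finite (roots P \<times> roots Q)")
  case True
  then show ?thesis by (auto simp: root_products_def poly_prod case_prod_beta)
qed (simp add: root_products_def)

lemma root_products_mult_mpow:
  assumes filt: "filtered F" and mult: "\<And>f g. F (fps_n_mult f g) = fps_n_mult (F f) (F g)"
    and deg: "degree P > 0" "degree Q > 0" and g: "g \<in> mpow a" "poly_op F P g \<in> mpow (a + c)"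
    and h: "h \<in> mpow b" "poly_op F Q h \<in> mpow (b + c)"
  shows "poly_op F (root_products P Q) (fps_n_mult g h) \<in> mpow (a + b + c)"
proof -
  let ?g = "\<lambda>\<mu>. poly_op F (partial_fraction P \<mu>) g"
    and ?h = "\<lambda>\<nu>. poly_op F (partial_fraction Q \<nu>) h"
  have finite: "finite (roots P \<times> roots Q)"
    using deg by (intro finite_cartesian_product poly_roots_finite) auto
  have "poly_op F (root_products P Q) (fps_n_mult (?g \<mu>) (?h \<nu>)) \<in> mpow (a + b + c)"
    if "\<mu> \<in> roots P" "\<nu> \<in> roots Q" for \<mu> \<nu>
  proof (rule poly_op_dvd_mpow[OF filt])
    have "poly P \<mu> = 0" "poly Q \<nu> = 0" using that by auto
    then show "poly_op F ([:- (\<mu> * \<nu>), 1:] ^ (degree P + degree Q)) (fps_n_mult (?g \<mu>) (?h \<nu>))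
        \<in> mpow (a + b + c)"
      by (intro poly_op_power_mult_mpow[OF filt mult] poly_op_mpow[OF filt g(1)]
          poly_op_mpow[OF filt h(1)] poly_op_partial_fraction_mpow[OF filt] deg g(2) h(2))
    show "[:- (\<mu> * \<nu>), 1:] ^ (degree P + degree Q) dvd root_products P Q"
      using that dvd_prodI[OF finite, of "(\<mu>, \<nu>)"
          "\<lambda>(\<mu>, \<nu>). [:- (\<mu> * \<nu>), 1:] ^ (degree P + degree Q)"]
      by (simp only: root_products_def prod.case mem_Sigma_iff simp_thms)
  qed
  moreover have "fps_n_mult g h = (\<Sum>\<nu>\<in>roots Q. \<Sum>\<mu>\<in>roots P. fps_n_mult (?g \<mu>) (?h \<nu>))"
    using sum_poly_op_partial_fraction[OF deg(1), of F g]
      sum_poly_op_partial_fraction[OF deg(2), of F h]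
    by (simp only: flip: fps_n_mult_sum_left fps_n_mult_sum_right)
  ultimately show ?thesis
    by (simp only: filtered_map_sum[OF filtered_poly_op[OF filt]]) (intro mpow_sum)
qed

lemma annihilates_jets_root_products:
  assumes F: "F \<in> formal_diff" and P: "annihilates_jets F P 2" and Q: "annihilates_jets F Q (Suc k)"
  shows "annihilates_jets F (root_products P Q * Q) (Suc (Suc k))"
proof -
  note filt = formal_diff_filtered[OF F]
  have deg: "degree P > 0" "degree Q > 0"
    using annihilates_jets_degree_pos P Q by (auto simp: numeral_2_eq_2)
  have "poly_op F (root_products P Q * Q) f \<in> mpow (Suc (Suc k))" for f
  proof -
    have "poly_op F Q f \<in> mpow (Suc k)" using Q by (simp add: annihilates_jets_def)
    then obtain g where g: "\<And>i. g i \<in> mpow k"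
      "poly_op F Q f = (\<Sum>i\<in>UNIV. fps_n_mult (fps_n_var i) (g i))"
      using mpow_Suc_decompose by blast
    have "poly_op F (root_products P Q) (fps_n_mult (fps_n_var i) (g i)) \<in> mpow (Suc 0 + k + Suc 0)"
      for i
      using P Q
      by (intro root_products_mult_mpow filt formal_diff_mult[OF F] deg fps_n_var_mpow g(1))
        (auto simp: annihilates_jets_def numeral_2_eq_2)
    then show ?thesis
      by (simp add: poly_op_mult[OF filtered_linear[OF filt]] g(2)
          filtered_map_sum[OF filtered_poly_op[OF filt]] mpow_sum)
  qed
  moreover have "root_products P Q * Q \<noteq> 0"
    using Q root_products_nonzero by (simp add: annihilates_jets_def)
  ultimately show ?thesis by (simp add: annihilates_jets_def)
qed

text \<open>A monoid containing the eigenvalues of \<open>F\<close> on 1-jets contains those on all jet spaces.\<close>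

locale eigenvalue_monoid =
  fixes F :: "'n::finite fps_n \<Rightarrow> 'n fps_n" and E :: "complex set"
  assumes F: "F \<in> formal_diff"
    and one: "1 \<in> E" and mult: "\<And>\<mu> \<nu>. \<mu> \<in> E \<Longrightarrow> \<nu> \<in> E \<Longrightarrow> \<mu> * \<nu> \<in> E" and nonzero: "0 \<notin> E"
    and linear_jet_annihilator: "\<exists>P. annihilates_jets F P 2 \<and> roots P \<subseteq> E"
begin

lemmas filt = formal_diff_filtered[OF F]
lemmas lin = filtered_linear[OF filt]

lemma exists_jet_annihilator: "\<exists>Q. annihilates_jets F Q (Suc k) \<and> roots Q \<subseteq> E"
proof -
  obtain P where P: "annihilates_jets F P 2" "roots P \<subseteq> E" using linear_jet_annihilator by blast
  show ?thesis
  proof (induction k)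
    case 0
    have "annihilates_jets F P (Suc 0)"
      using P(1) mpow_anti[of "Suc 0" 2] by (auto simp: annihilates_jets_def)
    then show ?case using P(2) by blast
  next
    case (Suc k)
    then obtain Q where Q: "annihilates_jets F Q (Suc k)" "roots Q \<subseteq> E" by blast
    have "roots (root_products P Q) \<subseteq> E"
      using roots_root_products[of P Q] P(2) Q(2) mult by blast
    then have "roots (root_products P Q * Q) \<subseteq> E" using Q(2) by auto
    with annihilates_jets_root_products[OF F P(1) Q(1)] show ?case by blast
  qed
qed

definition jet_annihilator :: "nat \<Rightarrow> complex poly" where
  "jet_annihilator k = (SOME Q. annihilates_jets F Q (Suc k) \<and> roots Q \<subseteq> E)"

definition eigenvalues :: "nat \<Rightarrow> complex set" where
  "eigenvalues k = roots (jet_annihilator k)"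

definition eigenprojection :: "nat \<Rightarrow> complex \<Rightarrow> 'n fps_n \<Rightarrow> 'n fps_n" where
  "eigenprojection k \<mu> = poly_op F (partial_fraction (jet_annihilator k) \<mu>)"

lemma jet_annihilator: "annihilates_jets F (jet_annihilator k) (Suc k)"
  and eigenvalue_in_E: "\<mu> \<in> eigenvalues k \<Longrightarrow> \<mu> \<in> E"
  using someI_ex[OF exists_jet_annihilator[of k]]
  unfolding jet_annihilator_def eigenvalues_def by auto

lemma filtered_eigenprojection: "filtered (eigenprojection k \<mu>)"
  unfolding eigenprojection_def by (rule filtered_poly_op[OF filt])

lemma sum_eigenprojection: "(\<Sum>\<mu>\<in>eigenvalues k. eigenprojection k \<mu> f) = f"
  unfolding eigenvalues_def eigenprojection_def
  by (rule sum_poly_op_partial_fraction[OF annihilates_jets_degree_pos[OF jet_annihilator]])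

definition gen_eigenspace :: "complex \<Rightarrow> nat \<Rightarrow> 'n fps_n set" where
  "gen_eigenspace \<mu> k = {f. \<exists>r. poly_op F ([:- \<mu>, 1:] ^ r) f \<in> mpow (Suc k)}"

lemma eigenprojection_power_mpow:
  assumes "\<mu> \<in> eigenvalues k"
  shows "poly_op F ([:- \<mu>, 1:] ^ degree (jet_annihilator k)) (eigenprojection k \<mu> f) \<in> mpow (Suc k)"
  using poly_op_partial_fraction_mpow[OF filt annihilates_jets_degree_pos[OF jet_annihilator]]
    assms jet_annihilator[of k]
  unfolding eigenprojection_def eigenvalues_def annihilates_jets_def by blast

lemma eigenprojection_gen_eigenspace:
  "\<mu> \<in> eigenvalues k \<Longrightarrow> eigenprojection k \<mu> f \<in> gen_eigenspace \<mu> k"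
  using eigenprojection_power_mpow unfolding gen_eigenspace_def by blast

lemma gen_eigenspace_poly_op: "f \<in> gen_eigenspace \<mu> k \<Longrightarrow> poly_op F P f \<in> gen_eigenspace \<mu> k"
  unfolding gen_eigenspace_def using poly_op_mpow[OF filt] poly_op_commute[OF lin] by fastforce

lemma gen_eigenspace_F: "f \<in> gen_eigenspace \<mu> k \<Longrightarrow> F f \<in> gen_eigenspace \<mu> k"
  using gen_eigenspace_poly_op[of f \<mu> k "[:0, 1:]"] by (simp only: poly_op_X[OF lin])

lemma gen_eigenspace_anti: "f \<in> gen_eigenspace \<mu> k \<Longrightarrow> j \<le> k \<Longrightarrow> f \<in> gen_eigenspace \<mu> j"
  unfolding gen_eigenspace_def using mpow_anti[of "Suc j" "Suc k"] by blast

lemma gen_eigenspace_mult: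
  assumes "g \<in> gen_eigenspace \<mu> k" "h \<in> gen_eigenspace \<nu> k"
  shows "fps_n_mult g h \<in> gen_eigenspace (\<mu> * \<nu>) k"
proof -
  obtain r s where "poly_op F ([:- \<mu>, 1:] ^ r) g \<in> mpow (0 + Suc k)"
    "poly_op F ([:- \<nu>, 1:] ^ s) h \<in> mpow (0 + Suc k)"
    using assms by (auto simp: gen_eigenspace_def)
  from poly_op_power_mult_mpow[OF filt formal_diff_mult[OF F] mpow_0 mpow_0 this]
  show ?thesis by (auto simp: gen_eigenspace_def)
qed

lemma gen_eigenspace_one: "fps_n_one \<in> gen_eigenspace 1 k"
proof -
  have "poly_op F ([:- 1, 1:] ^ 1) fps_n_one = F fps_n_one - scale 1 fps_n_one"
    by (simp only: power_one_right poly_op_linear_factor[OF lin])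
  also have "\<dots> \<in> mpow (Suc k)" by (simp add: formal_diff_one[OF F])
  finally show ?thesis unfolding gen_eigenspace_def by blast
qed

lemma gen_eigenspace_disjoint:
  assumes "f \<in> gen_eigenspace \<mu> k" "f \<in> gen_eigenspace \<nu> k" "\<mu> \<noteq> \<nu>"
  shows "f \<in> mpow (Suc k)"
  using assms(1,2) poly_op_coprime_mpow[OF filt coprime_linear_powers[OF assms(3)]]
  unfolding gen_eigenspace_def by blast

lemma cong_on_gen_eigenspaces:
  assumes "filtered \<phi>" "filtered \<psi>"
    and "\<And>\<mu> g. \<mu> \<in> E \<Longrightarrow> g \<in> gen_eigenspace \<mu> k \<Longrightarrow> \<phi> g - \<psi> g \<in> mpow (Suc k)"
  shows "\<phi> f - \<psi> f \<in> mpow (Suc k)"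
proof -
  have "\<phi> f - \<psi> f = \<phi> (\<Sum>\<mu>\<in>eigenvalues k. eigenprojection k \<mu> f) -
      \<psi> (\<Sum>\<mu>\<in>eigenvalues k. eigenprojection k \<mu> f)"
    by (simp only: sum_eigenprojection)
  also have "\<dots> = (\<Sum>\<mu>\<in>eigenvalues k. \<phi> (eigenprojection k \<mu> f) - \<psi> (eigenprojection k \<mu> f))"
    by (simp add: filtered_map_sum assms(1,2) sum_subtractf)
  also have "\<dots> \<in> mpow (Suc k)"
    by (intro mpow_sum assms(3)[OF eigenvalue_in_E eigenprojection_gen_eigenspace])
  finally show ?thesis .
qed

definition semisimple_jet :: "(complex \<Rightarrow> complex) \<Rightarrow> nat \<Rightarrow> 'n fps_n \<Rightarrow> 'n fps_n" where
  "semisimple_jet \<chi> k f = (\<Sum>\<mu>\<in>eigenvalues k. scale (\<chi> \<mu>) (eigenprojection k \<mu> f))"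

definition semisimple :: "(complex \<Rightarrow> complex) \<Rightarrow> 'n fps_n \<Rightarrow> 'n fps_n" where
  "semisimple \<chi> f = (\<lambda>\<alpha>. semisimple_jet \<chi> (mdeg \<alpha>) f \<alpha>)"

lemma filtered_semisimple_jet: "filtered (semisimple_jet \<chi> k)"
  unfolding semisimple_jet_def by (intro filtered_sum filtered_scale filtered_eigenprojection)

lemma semisimple_jet_gen_eigenspace:
  assumes "f \<in> gen_eigenspace \<mu> j" "j \<le> k"
  shows "semisimple_jet \<chi> k f - scale (\<chi> \<mu>) f \<in> mpow (Suc j)"
proof -
  have "semisimple_jet \<chi> k f - scale (\<chi> \<mu>) f =
      semisimple_jet \<chi> k f - scale (\<chi> \<mu>) (\<Sum>\<nu>\<in>eigenvalues k. eigenprojection k \<nu> f)"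
    by (simp only: sum_eigenprojection)
  also have "\<dots> = (\<Sum>\<nu>\<in>eigenvalues k. scale (\<chi> \<nu> - \<chi> \<mu>) (eigenprojection k \<nu> f))"
    by (simp add: semisimple_jet_def fps_n.scale_sum_right sum_subtractf
        fps_n.scale_left_diff_distrib)
  also have "\<dots> \<in> mpow (Suc j)"
  proof (intro mpow_sum)
    fix \<nu> assume \<nu>: "\<nu> \<in> eigenvalues k"
    show "scale (\<chi> \<nu> - \<chi> \<mu>) (eigenprojection k \<nu> f) \<in> mpow (Suc j)"
    proof (cases "\<nu> = \<mu>")
      case False
      have "eigenprojection k \<nu> f \<in> gen_eigenspace \<nu> j" "eigenprojection k \<nu> f \<in> gen_eigenspace \<mu> j"
        using gen_eigenspace_anti[OF eigenprojection_gen_eigenspace[OF \<nu>] assms(2)]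
          gen_eigenspace_poly_op[OF assms(1)] by (auto simp: eigenprojection_def)
      then show ?thesis using False by (intro mpow_scale gen_eigenspace_disjoint)
    qed simp
  qed
  finally show ?thesis .
qed

lemma semisimple_cong_jet: "semisimple \<chi> f - semisimple_jet \<chi> k f \<in> mpow (Suc k)"
proof -
  have "semisimple_jet \<chi> (mdeg \<alpha>) f \<alpha> = semisimple_jet \<chi> k f \<alpha>" if "mdeg \<alpha> \<le> k" for \<alpha>
  proof -
    have "semisimple_jet \<chi> (mdeg \<alpha>) f - semisimple_jet \<chi> k f \<in> mpow (Suc (mdeg \<alpha>))"
    proof (rule cong_on_gen_eigenspaces[OF filtered_semisimple_jet filtered_semisimple_jet])
      fix \<mu> g assume g: "g \<in> gen_eigenspace \<mu> (mdeg \<alpha>)"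
      show "semisimple_jet \<chi> (mdeg \<alpha>) g - semisimple_jet \<chi> k g \<in> mpow (Suc (mdeg \<alpha>))"
        by (rule mpow_cong_common[OF semisimple_jet_gen_eigenspace[OF g order_refl]
              semisimple_jet_gen_eigenspace[OF g that]])
    qed
    then show ?thesis by (auto simp: mpow_def pointwise)
  qed
  then show ?thesis by (auto simp: mpow_def semisimple_def pointwise)
qed

lemma filtered_semisimple: "filtered (semisimple \<chi>)"
  unfolding filtered_def linear_op_iff
proof (intro conjI allI ballI)
  show "semisimple \<chi> (f + g) = semisimple \<chi> f + semisimple \<chi> g" for f g
    by (simp add: semisimple_def filtered_map_add[OF filtered_semisimple_jet] fun_eq_iff pointwise)
  show "semisimple \<chi> (scale c f) = scale c (semisimple \<chi> f)" for c f
    by (simp add: semisimple_def filtered_map_scale[OF filtered_semisimple_jet] fun_eq_iff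
        scale_apply)
  show "semisimple \<chi> f \<in> mpow k" if "f \<in> mpow k" for k f
    using that filtered_mpow[OF filtered_semisimple_jet] by (auto simp: mpow_def semisimple_def)
qed

lemma semisimple_gen_eigenspace:
  "f \<in> gen_eigenspace \<mu> k \<Longrightarrow> semisimple \<chi> f - scale (\<chi> \<mu>) f \<in> mpow (Suc k)"
  by (rule mpow_cong_trans[OF semisimple_cong_jet semisimple_jet_gen_eigenspace[OF _ order_refl]])

lemma semisimple_eqI:
  assumes "filtered \<phi>"
    and "\<And>\<mu> f k. \<mu> \<in> E \<Longrightarrow> f \<in> gen_eigenspace \<mu> k \<Longrightarrow> \<phi> f - scale (\<chi> \<mu>) f \<in> mpow (Suc k)"
  shows "\<phi> = semisimple \<chi>"
proof
  fix f
  show "\<phi> f = semisimple \<chi> f"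
  proof (rule fps_n_eqI_mpow, rule cong_on_gen_eigenspaces[OF assms(1) filtered_semisimple])
    fix \<mu> f k assume "\<mu> \<in> E" and f: "f \<in> gen_eigenspace \<mu> k"
    from mpow_cong_common[OF assms(2)[OF this] semisimple_gen_eigenspace[OF f, of \<chi>]]
    show "\<phi> f - semisimple \<chi> f \<in> mpow (Suc k)" .
  qed
qed

lemma semisimple_cong: "(\<And>\<mu>. \<mu> \<in> E \<Longrightarrow> \<chi> \<mu> = \<chi>' \<mu>) \<Longrightarrow> semisimple \<chi> = semisimple \<chi>'"
  by (rule semisimple_eqI[OF filtered_semisimple]) (metis semisimple_gen_eigenspace)

lemma semisimple_one: "semisimple (\<lambda>_. 1) = id"
  by (rule semisimple_eqI[symmetric, OF filtered_id(1)]) simp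

lemma semisimple_comp: "semisimple \<chi> \<circ> semisimple \<chi>' = semisimple (\<lambda>\<mu>. \<chi> \<mu> * \<chi>' \<mu>)"
proof (rule semisimple_eqI)
  show "filtered (semisimple \<chi> \<circ> semisimple \<chi>')" by (intro filtered_comp filtered_semisimple)
  fix \<mu> f k assume f: "f \<in> gen_eigenspace \<mu> k"
  have "semisimple \<chi> (semisimple \<chi>' f) - semisimple \<chi> (scale (\<chi>' \<mu>) f) \<in> mpow (Suc k)"
    by (rule filtered_cong[OF filtered_semisimple semisimple_gen_eigenspace[OF f]])
  moreover have "semisimple \<chi> (scale (\<chi>' \<mu>) f) - scale (\<chi> \<mu> * \<chi>' \<mu>) f \<in> mpow (Suc k)"
    using mpow_scale[OF semisimple_gen_eigenspace[OF f], of "\<chi>' \<mu>" \<chi>]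
    by (simp add: fps_n.scale_right_diff_distrib filtered_map_scale[OF filtered_semisimple]
        mult.commute)
  ultimately show "(semisimple \<chi> \<circ> semisimple \<chi>') f - scale (\<chi> \<mu> * \<chi>' \<mu>) f \<in> mpow (Suc k)"
    unfolding comp_apply by (rule mpow_cong_trans)
qed

lemma semisimple_commute:
  assumes "filtered \<psi>" "\<psi> \<circ> F = F \<circ> \<psi>"
  shows "\<psi> \<circ> semisimple \<chi> = semisimple \<chi> \<circ> \<psi>"
proof
  fix f
  show "(\<psi> \<circ> semisimple \<chi>) f = (semisimple \<chi> \<circ> \<psi>) f"
  proof (rule fps_n_eqI_mpow)
    fix k
    have "\<psi> (semisimple \<chi> f) - \<psi> (semisimple_jet \<chi> k f) \<in> mpow (Suc k)"
      by (rule filtered_cong[OF assms(1) semisimple_cong_jet])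
    moreover have "\<psi> (semisimple_jet \<chi> k f) = semisimple_jet \<chi> k (\<psi> f)"
      by (simp add: semisimple_jet_def eigenprojection_def filtered_map_sum[OF assms(1)]
          filtered_map_scale[OF assms(1)]
          poly_op_intertwine[OF filtered_linear[OF assms(1)] assms(2)])
    ultimately show "(\<psi> \<circ> semisimple \<chi>) f - (semisimple \<chi> \<circ> \<psi>) f \<in> mpow (Suc k)"
      using mpow_cong_common[OF _ semisimple_cong_jet[of \<chi> "\<psi> f" k]] by simp
  qed
qed

definition character :: "(complex \<Rightarrow> complex) \<Rightarrow> bool" where
  "character \<chi> \<longleftrightarrow> \<chi> 1 = 1 \<and> (\<forall>\<mu>\<in>E. \<forall>\<nu>\<in>E. \<chi> (\<mu> * \<nu>) = \<chi> \<mu> * \<chi> \<nu>) \<and> (\<forall>\<mu>\<in>E. \<chi> \<mu> \<noteq> 0)"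

lemma semisimple_mult_gen_eigenspace:
  assumes "character \<chi>" "\<mu> \<in> E" "\<nu> \<in> E" and g: "g \<in> gen_eigenspace \<mu> k"
    and h: "h \<in> gen_eigenspace \<nu> k"
  shows "semisimple \<chi> (fps_n_mult g h) - fps_n_mult (semisimple \<chi> g) (semisimple \<chi> h)
    \<in> mpow (Suc k)"
proof -
  have "semisimple \<chi> (fps_n_mult g h) - scale (\<chi> (\<mu> * \<nu>)) (fps_n_mult g h) \<in> mpow (Suc k)"
    by (rule semisimple_gen_eigenspace[OF gen_eigenspace_mult[OF g h]])
  moreover have "scale (\<chi> (\<mu> * \<nu>)) (fps_n_mult g h) = fps_n_mult (scale (\<chi> \<mu>) g) (scale (\<chi> \<nu>) h)"
    using assms
    by (simp add: character_def fps_n_mult_scale_left fps_n_mult_scale_right mult.commute)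
  moreover have "fps_n_mult (semisimple \<chi> g) (semisimple \<chi> h) -
      fps_n_mult (scale (\<chi> \<mu>) g) (scale (\<chi> \<nu>) h) \<in> mpow (Suc k)"
    by (intro mpow_mult_cong semisimple_gen_eigenspace g h)
  ultimately show ?thesis using mpow_cong_common by metis
qed

lemma semisimple_mult:
  assumes "character \<chi>"
  shows "semisimple \<chi> (fps_n_mult f g) = fps_n_mult (semisimple \<chi> f) (semisimple \<chi> g)"
proof (rule fps_n_eqI_mpow)
  fix k
  let ?f = "\<lambda>\<mu>. eigenprojection k \<mu> f" and ?g = "\<lambda>\<nu>. eigenprojection k \<nu> g"
  let ?S = "\<lambda>D. \<Sum>\<nu>\<in>eigenvalues k. \<Sum>\<mu>\<in>eigenvalues k. D (?f \<mu>) (?g \<nu>)"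
  note expand = fps_n_mult_sum_left fps_n_mult_sum_right filtered_map_sum[OF filtered_semisimple]
  have "semisimple \<chi> (fps_n_mult f g) = ?S (\<lambda>f g. semisimple \<chi> (fps_n_mult f g))"
    using sum_eigenprojection[of k f] sum_eigenprojection[of k g] by (simp only: flip: expand)
  moreover have "fps_n_mult (semisimple \<chi> f) (semisimple \<chi> g) =
      ?S (\<lambda>f g. fps_n_mult (semisimple \<chi> f) (semisimple \<chi> g))"
    using sum_eigenprojection[of k f] sum_eigenprojection[of k g] by (simp only: flip: expand)
  ultimately have "semisimple \<chi> (fps_n_mult f g) - fps_n_mult (semisimple \<chi> f) (semisimple \<chi> g) =
      ?S (\<lambda>f g. semisimple \<chi> (fps_n_mult f g) - fps_n_mult (semisimple \<chi> f) (semisimple \<chi> g))"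
    by (simp only: sum_subtractf)
  also have "\<dots> \<in> mpow (Suc k)"
    by (intro mpow_sum semisimple_mult_gen_eigenspace[OF assms eigenvalue_in_E eigenvalue_in_E
          eigenprojection_gen_eigenspace eigenprojection_gen_eigenspace])
  finally show "semisimple \<chi> (fps_n_mult f g) - fps_n_mult (semisimple \<chi> f) (semisimple \<chi> g)
      \<in> mpow (Suc k)" .
qed

lemma semisimple_formal_diff:
  assumes "character \<chi>" shows "semisimple \<chi> \<in> formal_diff"
proof (rule formal_diffI)
  have "semisimple \<chi> \<circ> semisimple (\<lambda>\<mu>. inverse (\<chi> \<mu>)) = id"
    "semisimple (\<lambda>\<mu>. inverse (\<chi> \<mu>)) \<circ> semisimple \<chi> = id"
    using assms unfolding semisimple_comp semisimple_one[symmetric]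
    by (auto intro!: semisimple_cong simp: character_def)
  then show "bij (semisimple \<chi>)" by (intro o_bij)
  show "semisimple \<chi> fps_n_one = fps_n_one"
    using semisimple_gen_eigenspace[OF gen_eigenspace_one, of \<chi>] assms
    by (intro fps_n_eqI_mpow) (simp add: character_def)
qed (use filtered_semisimple semisimple_mult[OF assms] in auto)

lemma jet_entry_semisimple:
  "jet_entry (semisimple \<chi>) \<alpha> \<beta> =
    (\<Sum>\<mu>\<in>eigenvalues (mdeg \<alpha>). \<chi> \<mu> * jet_entry (eigenprojection (mdeg \<alpha>) \<mu>) \<alpha> \<beta>)"
  by (simp add: jet_entry_def semisimple_def semisimple_jet_def sum_fun_apply scale_apply)

definition unipotent_part :: "'n fps_n \<Rightarrow> 'n fps_n" where
  "unipotent_part = semisimple inverse \<circ> F"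

lemma unipotent_part_formal_diff: "unipotent_part \<in> formal_diff"
proof -
  have "character inverse" using nonzero by (auto simp: character_def)
  then show ?thesis
    unfolding unipotent_part_def by (intro formal_diff_comp semisimple_formal_diff F)
qed

lemma semisimple_unipotent_part: "semisimple (\<lambda>\<mu>. \<mu>) \<circ> unipotent_part = F"
proof -
  have "semisimple (\<lambda>\<mu>. \<mu>) \<circ> semisimple inverse = id"
    unfolding semisimple_comp semisimple_one[symmetric] using nonzero
    by (intro semisimple_cong) (metis right_inverse)
  then show ?thesis unfolding unipotent_part_def by (metis comp_assoc id_comp)
qed

lemma unipotent_part_commute:
  assumes "filtered \<psi>" "\<psi> \<circ> F = F \<circ> \<psi>"
  shows "\<psi> \<circ> unipotent_part = unipotent_part \<circ> \<psi>"
  unfolding unipotent_part_def using semisimple_commute[OF assms] assms(2) by (metis comp_assoc)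

lemma unipotent_part_minus_id_gen_eigenspace:
  assumes "\<mu> \<in> E" "f \<in> gen_eigenspace \<mu> k"
  shows "unipotent_part f - f - scale (inverse \<mu>) (poly_op F [:- \<mu>, 1:] f) \<in> mpow (Suc k)"
proof -
  have "inverse \<mu> * \<mu> = 1" using assms(1) nonzero by (metis left_inverse)
  then have "scale (inverse \<mu>) (poly_op F [:- \<mu>, 1:] f) = scale (inverse \<mu>) (F f) - f"
    by (simp only: poly_op_linear_factor[OF lin] fps_n.scale_right_diff_distrib fps_n.scale_scale
        fps_n.scale_one)
  then show ?thesis
    using semisimple_gen_eigenspace[OF gen_eigenspace_F[OF assms(2)], of inverse]
    by (simp add: unipotent_part_def)
qed

lemma unipotent_part_minus_id_power_gen_eigenspace:
  assumes "\<mu> \<in> E" "f \<in> gen_eigenspace \<mu> k"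
  shows "((\<lambda>f. unipotent_part f - f) ^^ j) f - scale (inverse \<mu> ^ j) (poly_op F ([:- \<mu>, 1:] ^ j) f)
    \<in> mpow (Suc k)"
proof (induction j)
  case (Suc j)
  let ?g = "poly_op F ([:- \<mu>, 1:] ^ j) f" and ?N = "\<lambda>f. unipotent_part f - f"
  have N: "filtered ?N"
    by (intro filtered_diff filtered_id formal_diff_filtered unipotent_part_formal_diff)
  have "(?N ^^ Suc j) f - scale (inverse \<mu> ^ j) (?N ?g) \<in> mpow (Suc k)"
    using filtered_cong[OF N Suc.IH]
    by (simp only: filtered_map_scale[OF N] funpow.simps comp_apply)
  moreover have "scale (inverse \<mu> ^ j) (?N ?g) -
      scale (inverse \<mu> ^ Suc j) (poly_op F ([:- \<mu>, 1:] ^ Suc j) f) \<in> mpow (Suc k)"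
    using mpow_scale[OF unipotent_part_minus_id_gen_eigenspace[OF assms(1)],
        OF gen_eigenspace_poly_op[OF assms(2)], of "inverse \<mu> ^ j" "[:- \<mu>, 1:] ^ j"]
    by (simp only: fps_n.scale_right_diff_distrib fps_n.scale_scale power_Suc poly_op_mult[OF lin]
        mult.commute)
  ultimately show ?case by (rule mpow_cong_trans)
qed simp

lemma unipotent_part_nilpotent: "\<exists>r. \<forall>f. ((\<lambda>f. unipotent_part f - f) ^^ r) f \<in> mpow (Suc k)"
proof (intro exI allI)
  let ?N = "\<lambda>f. unipotent_part f - f" and ?r = "degree (jet_annihilator k)"
  have N: "filtered (?N ^^ ?r)"
    by (intro filtered_funpow filtered_diff filtered_id formal_diff_filtered
        unipotent_part_formal_diff)
  fix f
  have "(?N ^^ ?r) f = (\<Sum>\<mu>\<in>eigenvalues k. (?N ^^ ?r) (eigenprojection k \<mu> f))"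
    by (simp only: sum_eigenprojection flip: filtered_map_sum[OF N])
  also have "\<dots> \<in> mpow (Suc k)"
  proof (intro mpow_sum)
    fix \<mu> assume \<mu>: "\<mu> \<in> eigenvalues k"
    show "(?N ^^ ?r) (eigenprojection k \<mu> f) \<in> mpow (Suc k)"
      by (rule mpow_cong_mem[OF unipotent_part_minus_id_power_gen_eigenspace
            mpow_scale[OF eigenprojection_power_mpow[OF \<mu>]]])
        (rule eigenvalue_in_E[OF \<mu>], rule eigenprojection_gen_eigenspace[OF \<mu>])
  qed
  finally show "(?N ^^ ?r) f \<in> mpow (Suc k)" .
qed

end

section \<open>Complex powers of a unipotent automorphism\<close>

definition is_poly :: "(complex \<Rightarrow> complex) \<Rightarrow> bool" where
  "is_poly h \<longleftrightarrow> (\<exists>p. \<forall>z. h z = poly p z)"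

lemma is_poly_const: "is_poly (\<lambda>z. c)"
  unfolding is_poly_def by (rule exI[of _ "[:c:]"]) simp

lemma is_poly_ident: "is_poly (\<lambda>z. z)"
  unfolding is_poly_def by (rule exI[of _ "[:0, 1:]"]) simp

lemma is_poly_add: "is_poly g \<Longrightarrow> is_poly h \<Longrightarrow> is_poly (\<lambda>z. g z + h z)"
  unfolding is_poly_def by (metis poly_add)

lemma is_poly_mult: "is_poly g \<Longrightarrow> is_poly h \<Longrightarrow> is_poly (\<lambda>z. g z * h z)"
  unfolding is_poly_def by (metis poly_mult)

lemma is_poly_compose: "is_poly g \<Longrightarrow> is_poly h \<Longrightarrow> is_poly (\<lambda>z. g (h z))"
  unfolding is_poly_def by (metis poly_pcompose)

lemma is_poly_sum: "(\<And>i. i \<in> I \<Longrightarrow> is_poly (h i)) \<Longrightarrow> is_poly (\<lambda>z. \<Sum>i\<in>I. h i z)"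
  by (induction I rule: infinite_finite_induct) (auto intro: is_poly_const is_poly_add)

lemma is_poly_prod: "(\<And>i. i \<in> I \<Longrightarrow> is_poly (h i)) \<Longrightarrow> is_poly (\<lambda>z. \<Prod>i\<in>I. h i z)"
  by (induction I rule: infinite_finite_induct) (auto intro: is_poly_const is_poly_mult)

lemma is_poly_gbinomial: "is_poly (\<lambda>z. z gchoose j)"
proof -
  have "is_poly (\<lambda>z. z + - of_nat i)" for i
    by (intro is_poly_add is_poly_ident is_poly_const)
  then have "is_poly (\<lambda>z. (\<Prod>i = 0..<j. z + - of_nat i) * inverse (fact j))"
    by (intro is_poly_mult is_poly_prod is_poly_const)
  then show ?thesis by (simp add: gbinomial_prod_rev field_simps)
qed

lemma is_poly_eqI:
  assumes "is_poly g" "is_poly h" "\<And>m::nat. g (of_nat m) = h (of_nat m)"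
  shows "g z = h z"
proof -
  obtain p r where p: "\<And>z. g z = poly p z" and r: "\<And>z. h z = poly r z"
    using assms(1,2) unfolding is_poly_def by blast
  have "range (of_nat :: nat \<Rightarrow> complex) \<subseteq> {z. poly (p - r) z = 0}"
    using assms(3) p r by auto
  moreover have "infinite (range (of_nat :: nat \<Rightarrow> complex))"
    by (simp add: finite_image_iff inj_of_nat)
  ultimately have "infinite {z. poly (p - r) z = 0}" using finite_subset by blast
  then have "p - r = 0" using poly_roots_finite by blast
  then show ?thesis by (simp add: p r)
qed

text \<open>Every coefficient of \<open>U\<^sup>z = (1 + N)\<^sup>z\<close> is a polynomial in \<open>z\<close>, hence all algebraic identities
  follow from the case where \<open>z\<close> is a natural number.\<close>

locale unipotent =
  fixes U :: "'n::finite fps_n \<Rightarrow> 'n fps_n"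
  assumes U: "U \<in> formal_diff"
    and nilpotent: "\<And>k. \<exists>r. \<forall>f. ((\<lambda>f. U f - f) ^^ r) f \<in> mpow (Suc k)"
begin

definition N :: "'n fps_n \<Rightarrow> 'n fps_n" where
  "N f = U f - f"

definition nilpotency_index :: "nat \<Rightarrow> nat" where
  "nilpotency_index k = (SOME r. \<forall>f. (N ^^ r) f \<in> mpow (Suc k))"

definition upow :: "complex \<Rightarrow> 'n fps_n \<Rightarrow> 'n fps_n" where
  "upow z f = (\<lambda>\<alpha>. \<Sum>j<nilpotency_index (mdeg \<alpha>). (z gchoose j) * (N ^^ j) f \<alpha>)"

lemma filtered_N_pow: "filtered (N ^^ j)"
  using filtered_diff[OF formal_diff_filtered[OF U] filtered_id(2)]
  by (intro filtered_funpow) (simp add: N_def[abs_def])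

lemma N_pow_mpow:
  assumes "nilpotency_index k \<le> j" shows "(N ^^ j) f \<in> mpow (Suc k)"
proof -
  have "\<exists>r. \<forall>f. (N ^^ r) f \<in> mpow (Suc k)" using nilpotent[of k] by (simp add: N_def[abs_def])
  then have "\<forall>f. (N ^^ nilpotency_index k) f \<in> mpow (Suc k)"
    unfolding nilpotency_index_def by (rule someI_ex)
  moreover have "(N ^^ j) f = (N ^^ nilpotency_index k) ((N ^^ (j - nilpotency_index k)) f)"
    using assms by (metis comp_apply funpow_add le_add_diff_inverse)
  ultimately show ?thesis by simp
qed

lemma upow_eq_sum:
  assumes "nilpotency_index (mdeg \<alpha>) \<le> M"
  shows "upow z f \<alpha> = (\<Sum>j<M. (z gchoose j) * (N ^^ j) f \<alpha>)"
  unfolding upow_def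
proof (rule sum.mono_neutral_left)
  show "\<forall>j\<in>{..<M} - {..<nilpotency_index (mdeg \<alpha>)}. (z gchoose j) * (N ^^ j) f \<alpha> = 0"
    using N_pow_mpow[of "mdeg \<alpha>" _ f] by (auto simp: mpow_def)
qed (use assms in auto)

lemma U_pow_binomial:
  assumes "m < M"
  shows "(U ^^ m) f = (\<Sum>j<M. scale (of_nat m gchoose j) ((N ^^ j) f))"
  using assms
proof (induction m arbitrary: M)
  case 0
  then obtain K where "M = Suc K" using gr0_implies_Suc by blast
  then show ?case by (simp add: sum.lessThan_Suc_shift gbinomial_0_left del: sum.lessThan_Suc)
next
  case (Suc m)
  then obtain K where K: "M = Suc K" "m < K" by (cases M) auto
  have U': "U g = g + N g" for g by (simp add: N_def)
  have pascal: "(of_nat m gchoose Suc j) + (of_nat m gchoose j) =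
      (of_nat (Suc m) gchoose Suc j :: complex)"
    for j using gbinomial_Suc_Suc[of "of_nat m :: complex" j] by (simp add: add.commute)
  have "(U ^^ Suc m) f = (U ^^ m) f + N ((U ^^ m) f)" by (simp add: U')
  also have "N ((U ^^ m) f) = (\<Sum>j<K. scale (of_nat m gchoose j) ((N ^^ Suc j) f))"
    using filtered_N_pow[of 1]
    by (simp add: Suc.IH[OF K(2)] filtered_map_sum[of N] filtered_map_scale[of N])
  also have "(U ^^ m) f = f + (\<Sum>j<K. scale (of_nat m gchoose Suc j) ((N ^^ Suc j) f))"
    using Suc.IH[of "Suc K"] K
    by (simp add: sum.lessThan_Suc_shift del: sum.lessThan_Suc funpow.simps)
  finally have "(U ^^ Suc m) f = f + (\<Sum>j<K. scale (of_nat (Suc m) gchoose Suc j) ((N ^^ Suc j) f))"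
    by (simp only: add.assoc sum.distrib[symmetric] fps_n.scale_left_distrib[symmetric] pascal)
  then show ?case
    by (simp add: K(1) sum.lessThan_Suc_shift del: sum.lessThan_Suc funpow.simps)
qed

lemma upow_nat: "upow (of_nat m) f = (U ^^ m) f"
proof
  fix \<alpha> :: "'n \<Rightarrow> nat"
  define M where "M = max (Suc m) (nilpotency_index (mdeg \<alpha>))"
  have "m < M" "nilpotency_index (mdeg \<alpha>) \<le> M" by (auto simp: M_def)
  then show "upow (of_nat m) f \<alpha> = (U ^^ m) f \<alpha>"
    by (simp add: upow_eq_sum U_pow_binomial[of m M] sum_fun_apply scale_apply)
qed

lemma upow_0: "upow 0 = id"
  using upow_nat[of 0] by auto

lemma upow_1: "upow 1 = U"
  using upow_nat[of 1] by auto

lemma is_poly_upow: "is_poly (\<lambda>z. upow z f \<alpha>)"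
  unfolding upow_def by (intro is_poly_sum is_poly_mult is_poly_gbinomial is_poly_const)

lemma filtered_upow: "filtered (upow z)"
  unfolding filtered_def linear_op_iff
proof (intro conjI allI ballI)
  note map = filtered_map_add[OF filtered_N_pow] filtered_map_scale[OF filtered_N_pow]
  show "upow z (f + g) = upow z f + upow z g" for f g
    by (simp add: upow_def map fun_eq_iff pointwise algebra_simps sum.distrib)
  show "upow z (scale c f) = scale c (upow z f)" for c f
    by (simp add: upow_def map fun_eq_iff scale_apply sum_distrib_left algebra_simps)
  show "upow z f \<in> mpow k" if "f \<in> mpow k" for k f
    using filtered_mpow[OF filtered_N_pow that] by (auto simp: mpow_def upow_def)
qed

lemma is_poly_filtered_upow: "filtered \<phi> \<Longrightarrow> is_poly (\<lambda>z. \<phi> (upow z f) \<alpha>)"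
  by (simp only: filtered_apply_eq[of \<phi>])
    (intro is_poly_sum is_poly_mult is_poly_upow is_poly_const)

lemma upow_add: "upow z \<circ> upow w = upow (z + w)"
proof (intro ext)
  fix f \<alpha>
  have poly_left: "is_poly (\<lambda>z. upow (z + w) f \<alpha>)"
    and poly_right: "is_poly (\<lambda>w. upow (z + w) f \<alpha>)" for z w
    by (intro is_poly_compose[OF is_poly_upow] is_poly_add is_poly_ident is_poly_const)+
  have nat: "upow z (upow (of_nat m) f) \<alpha> = upow (z + of_nat m) f \<alpha>" for m z
  proof (rule is_poly_eqI[OF is_poly_upow poly_left])
    show "upow (of_nat k) (upow (of_nat m) f) \<alpha> = upow (of_nat k + of_nat m) f \<alpha>" for k
      unfolding of_nat_add[symmetric] upow_nat by (simp add: funpow_add)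
  qed
  have "upow z (upow w f) \<alpha> = upow (z + w) f \<alpha>"
    by (rule is_poly_eqI[OF is_poly_filtered_upow[OF filtered_upow] poly_right]) (rule nat)
  then show "(upow z \<circ> upow w) f \<alpha> = upow (z + w) f \<alpha>" by simp
qed

lemma U_pow_formal_diff: "U ^^ m \<in> formal_diff"
  by (induction m) (simp_all only: funpow.simps formal_diff_id formal_diff_comp U)

lemma upow_mult: "upow z (fps_n_mult f g) = fps_n_mult (upow z f) (upow z g)"
proof
  fix \<alpha>
  have "is_poly (\<lambda>z. fps_n_mult (upow z f) (upow z g) \<alpha>)"
    unfolding fps_n_mult_def by (intro is_poly_sum is_poly_mult is_poly_upow)
  then show "upow z (fps_n_mult f g) \<alpha> = fps_n_mult (upow z f) (upow z g) \<alpha>"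
    by (rule is_poly_eqI[OF is_poly_upow])
      (simp add: upow_nat formal_diff_mult[OF U_pow_formal_diff])
qed

lemma upow_one: "upow z fps_n_one = fps_n_one"
proof
  fix \<alpha>
  show "upow z fps_n_one \<alpha> = fps_n_one \<alpha>"
    by (rule is_poly_eqI[OF is_poly_upow is_poly_const])
      (simp add: upow_nat formal_diff_one[OF U_pow_formal_diff])
qed

lemma upow_formal_diff: "upow z \<in> formal_diff"
proof (rule formal_diffI[OF filtered_upow _ upow_mult upow_one])
  have "upow z \<circ> upow (- z) = id" "upow (- z) \<circ> upow z = id"
    unfolding upow_add by (simp_all add: upow_0)
  then show "bij (upow z)" by (intro o_bij)
qed

lemma upow_commute:
  assumes "filtered \<psi>" "\<psi> \<circ> U = U \<circ> \<psi>"
  shows "\<psi> \<circ> upow z = upow z \<circ> \<psi>"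
proof (intro ext)
  fix f \<alpha>
  have "\<psi> (U g) = U (\<psi> g)" for g using assms(2) by (metis comp_apply)
  then have pow: "\<psi> ((U ^^ m) f) = (U ^^ m) (\<psi> f)" for m by (induction m) auto
  have "\<psi> (upow z f) \<alpha> = upow z (\<psi> f) \<alpha>"
    by (rule is_poly_eqI[OF is_poly_filtered_upow[OF assms(1)] is_poly_upow])
      (simp add: upow_nat pow)
  then show "(\<psi> \<circ> upow z) f \<alpha> = (upow z \<circ> \<psi>) f \<alpha>" by simp
qed

end

section \<open>Abelian linear algebraic groups\<close>

lemma polyfun_minus: "P \<in> polyfun N \<Longrightarrow> Q \<in> polyfun N \<Longrightarrow> (\<lambda>A. P A - Q A) \<in> polyfun N"
  using polyfun.add[OF _ polyfun.mult[OF polyfun.const[of "- 1"]], of P N Q] by simp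

lemma polyfun_power: "P \<in> polyfun N \<Longrightarrow> (\<lambda>A. P A ^ k) \<in> polyfun N"
  by (induction k) (auto intro: polyfun.const polyfun.mult)

lemma polyfun_prod: "(\<And>i. i \<in> I \<Longrightarrow> P i \<in> polyfun N) \<Longrightarrow> (\<lambda>A. \<Prod>i\<in>I. P i A) \<in> polyfun N"
  by (induction I rule: infinite_finite_induct) (auto intro: polyfun.const polyfun.mult)

lemma invertible_matI:
  "A \<in> carrier_mat n n \<Longrightarrow> B \<in> carrier_mat n n \<Longrightarrow> A * B = 1\<^sub>m n \<Longrightarrow> B * A = 1\<^sub>m n \<Longrightarrow> invertible_mat A"
  unfolding invertible_mat_def inverts_mat_def by auto

lemma invertible_matE:
  fixes A :: "'a::semiring_1 mat"
  assumes "invertible_mat A" "A \<in> carrier_mat n n"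
  obtains B where "B \<in> carrier_mat n n" "A * B = 1\<^sub>m n" "B * A = 1\<^sub>m n"
proof -
  obtain B where B: "A * B = 1\<^sub>m n" "B * A = 1\<^sub>m (dim_row B)"
    using assms unfolding invertible_mat_def inverts_mat_def by auto
  have "B \<in> carrier_mat n n"
    using arg_cong[OF B(1), of dim_col] arg_cong[OF B(2), of dim_col] assms(2) by auto
  with B show ?thesis by (intro that) auto
qed

lemma abelian_linear_algebraic_groupI:
  assumes carrier: "G \<subseteq> carrier_mat N N" and one: "1\<^sub>m N \<in> G"
    and mult: "\<And>A B. A \<in> G \<Longrightarrow> B \<in> G \<Longrightarrow> A * B \<in> G"
    and inverse: "\<And>A. A \<in> G \<Longrightarrow> \<exists>B\<in>G. A * B = 1\<^sub>m N"
    and commute: "\<And>A B. A \<in> G \<Longrightarrow> B \<in> G \<Longrightarrow> A * B = B * A"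
    and S: "S \<subseteq> polyfun N" "\<And>A P. A \<in> G \<Longrightarrow> P \<in> S \<Longrightarrow> P A = 0"
      "\<And>A. A \<in> carrier_mat N N \<Longrightarrow> invertible_mat A \<Longrightarrow> (\<And>P. P \<in> S \<Longrightarrow> P A = 0) \<Longrightarrow> A \<in> G"
  shows "abelian_linear_algebraic_group N G"
proof -
  have invertible: "invertible_mat A" if A: "A \<in> G" for A
    using inverse[OF A] commute[OF A] A carrier by (metis invertible_matI subsetD)
  have "G = {A \<in> carrier_mat N N. invertible_mat A \<and> (\<forall>P\<in>S. P A = 0)}"
    using carrier S(2,3) invertible by blast
  then have "\<exists>S\<subseteq>polyfun N. G = {A \<in> carrier_mat N N. invertible_mat A \<and> (\<forall>P\<in>S. P A = 0)}"
    using S(1) by blast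
  then show ?thesis
    unfolding abelian_linear_algebraic_group_def
    by (intro conjI ballI carrier invertible one mult inverse commute)
qed

lemma
  assumes "abelian_linear_algebraic_group N G"
  shows abelian_linear_algebraic_group_carrier: "A \<in> G \<Longrightarrow> A \<in> carrier_mat N N"
    and abelian_linear_algebraic_group_one: "1\<^sub>m N \<in> G"
    and abelian_linear_algebraic_group_mult: "A \<in> G \<Longrightarrow> B \<in> G \<Longrightarrow> A * B \<in> G"
    and abelian_linear_algebraic_group_commute: "A \<in> G \<Longrightarrow> B \<in> G \<Longrightarrow> A * B = B * A"
  using assms by (simp_all add: abelian_linear_algebraic_group_def subset_iff)

lemma abelian_linear_algebraic_group_inverse:
  assumes "abelian_linear_algebraic_group N G" "A \<in> G"
  shows "\<exists>B\<in>G. A * B = 1\<^sub>m N"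
proof -
  have "\<forall>A\<in>G. \<exists>B\<in>G. A * B = 1\<^sub>m N"
    using assms(1) unfolding abelian_linear_algebraic_group_def by (elim conjE)
  then show ?thesis using assms(2) by (rule bspec)
qed

definition mat_nhds :: "nat \<Rightarrow> complex mat set \<Rightarrow> complex mat \<Rightarrow> complex mat filter" where
  "mat_nhds N G A =
    (INF \<delta>\<in>{0<..}. principal {B \<in> G. \<forall>i<N. \<forall>j<N. cmod (B $$ (i, j) - A $$ (i, j)) < \<delta>})"

lemma eventually_mat_nhds:
  "eventually P (mat_nhds N G A) \<longleftrightarrow>
    (\<exists>\<delta>>0. \<forall>B\<in>G. (\<forall>i<N. \<forall>j<N. cmod (B $$ (i, j) - A $$ (i, j)) < \<delta>) \<longrightarrow> P B)"
  unfolding mat_nhds_def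
proof (subst eventually_INF_base)
  fix a b :: real assume "a \<in> {0<..}" "b \<in> {0<..}"
  then show "\<exists>x\<in>{0<..}. principal {B \<in> G. \<forall>i<N. \<forall>j<N. cmod (B $$ (i, j) - A $$ (i, j)) < x}
      \<le> inf (principal {B \<in> G. \<forall>i<N. \<forall>j<N. cmod (B $$ (i, j) - A $$ (i, j)) < a})
         (principal {B \<in> G. \<forall>i<N. \<forall>j<N. cmod (B $$ (i, j) - A $$ (i, j)) < b})"
    by (intro bexI[of _ "min a b"]) auto
qed (auto simp: eventually_principal)

lemma eventually_mat_nhdsI: "(\<And>B. B \<in> G \<Longrightarrow> P B) \<Longrightarrow> eventually P (mat_nhds N G A)"
  unfolding eventually_mat_nhds by (intro exI[of _ 1]) auto

lemma mat_continuous_on_iff_tendsto: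
  "mat_continuous_on N G f \<longleftrightarrow> (\<forall>A\<in>G. (f \<longlongrightarrow> f A) (mat_nhds N G A))"
  by (simp add: mat_continuous_on_def tendsto_iff eventually_mat_nhds dist_norm)

lemma tendsto_mat_entry:
  "i < N \<Longrightarrow> j < N \<Longrightarrow> ((\<lambda>B. B $$ (i, j)) \<longlongrightarrow> A $$ (i, j)) (mat_nhds N G A)"
  unfolding tendsto_iff eventually_mat_nhds dist_norm by blast

lemma lie_hom_mat_iff:
  fixes r :: "complex mat \<Rightarrow> 'n::finite fps_n \<Rightarrow> 'n fps_n"
  shows "lie_hom_mat N G r \<longleftrightarrow> r ` G \<subseteq> formal_diff \<and> (\<forall>A\<in>G. \<forall>B\<in>G. r (A * B) = r A \<circ> r B) \<and>
    (\<forall>\<alpha> \<beta>. \<forall>A\<in>G. ((\<lambda>B. jet_entry (r B) \<alpha> \<beta>) \<longlongrightarrow> jet_entry (r A) \<alpha> \<beta>) (mat_nhds N G A))"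
proof -
  have "(\<forall>k \<alpha> \<beta>. sum \<alpha> UNIV \<le> k \<and> sum \<beta> UNIV \<le> k \<longrightarrow> P \<alpha> \<beta>) \<longleftrightarrow> (\<forall>\<alpha> \<beta>. P \<alpha> \<beta>)"
    for P :: "('n \<Rightarrow> nat) \<Rightarrow> ('n \<Rightarrow> nat) \<Rightarrow> bool"
    by (meson max.cobounded1 max.cobounded2)
  then show ?thesis unfolding lie_hom_mat_def mat_continuous_on_iff_tendsto by simp
qed

lemma lie_hom_mat_tendsto:
  "lie_hom_mat N G r \<Longrightarrow> A \<in> G \<Longrightarrow>
    ((\<lambda>B. jet_entry (r B) \<alpha> \<beta>) \<longlongrightarrow> jet_entry (r A) \<alpha> \<beta>) (mat_nhds N G A)"
  by (simp add: lie_hom_mat_iff)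

definition algebraic_diff_group :: "('n::finite fps_n \<Rightarrow> 'n fps_n) set \<Rightarrow> bool" where
  "algebraic_diff_group H \<longleftrightarrow>
    (\<exists>N G r. abelian_linear_algebraic_group N G \<and> lie_hom_mat N G r \<and> r ` G = H)"

lemma algebraic_diff_groupE:
  assumes "algebraic_diff_group H"
  obtains N G r where "abelian_linear_algebraic_group N G" "lie_hom_mat N G r" "r ` G = H"
  using assms unfolding algebraic_diff_group_def by blast

lemma algebraic_diff_group_formal_diff: "algebraic_diff_group H \<Longrightarrow> H \<subseteq> formal_diff"
  by (elim algebraic_diff_groupE) (auto simp: lie_hom_mat_iff)

lemma algebraic_diff_group_filtered: "algebraic_diff_group H \<Longrightarrow> \<phi> \<in> H \<Longrightarrow> filtered \<phi>"
  using algebraic_diff_group_formal_diff formal_diff_filtered by blast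

lemma algebraic_diff_group_comp:
  assumes "algebraic_diff_group H" "\<phi> \<in> H" "\<psi> \<in> H" shows "\<phi> \<circ> \<psi> \<in> H"
proof -
  obtain N G r where G: "abelian_linear_algebraic_group N G" "lie_hom_mat N G r" "r ` G = H"
    using assms(1) by (rule algebraic_diff_groupE)
  then obtain A B where "A \<in> G" "B \<in> G" "\<phi> = r A" "\<psi> = r B" using assms(2,3) by blast
  then have "A * B \<in> G" "\<phi> \<circ> \<psi> = r (A * B)"
    using G(2) abelian_linear_algebraic_group_mult[OF G(1)] by (simp_all add: lie_hom_mat_def)
  then show ?thesis using G(3) by blast
qed

lemma lie_hom_mat_one:
  assumes "abelian_linear_algebraic_group N G" "lie_hom_mat N G r"
  shows "r (1\<^sub>m N) = id"
proof -
  let ?e = "r (1\<^sub>m N)"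
  have "1\<^sub>m N \<in> G" by (rule abelian_linear_algebraic_group_one[OF assms(1)])
  then have "r (1\<^sub>m N * 1\<^sub>m N) = ?e \<circ> ?e" and "bij ?e"
    using assms(2) formal_diff_bij unfolding lie_hom_mat_def by blast+
  then have "?e (?e f) = ?e f" for f by (metis comp_apply left_mult_one_mat one_carrier_mat)
  then show ?thesis using \<open>bij ?e\<close> by (metis bij_is_inj eq_id_iff inj_eq)
qed

lemma algebraic_diff_group_id:
  assumes "algebraic_diff_group H" shows "id \<in> H"
proof -
  obtain N G r where G: "abelian_linear_algebraic_group N G" "lie_hom_mat N G r" "r ` G = H"
    using assms by (rule algebraic_diff_groupE)
  then have "1\<^sub>m N \<in> G" by (intro abelian_linear_algebraic_group_one)
  then show ?thesis using G(3) lie_hom_mat_one[OF G(1,2)] by force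
qed

lemma algebraic_diff_group_inverse:
  assumes H: "algebraic_diff_group H" "\<phi> \<in> H" and \<psi>: "\<psi> \<circ> \<phi> = id"
  shows "\<psi> \<in> H"
proof -
  obtain N G r where G: "abelian_linear_algebraic_group N G" "lie_hom_mat N G r" "r ` G = H"
    using H(1) by (rule algebraic_diff_groupE)
  then obtain A B where AB: "A \<in> G" "B \<in> G" "\<phi> = r A" "A * B = 1\<^sub>m N"
    using H(2) abelian_linear_algebraic_group_inverse[OF G(1)] by blast
  then have "\<phi> \<circ> r B = id"
    using G(2) lie_hom_mat_one[OF G(1,2)] unfolding lie_hom_mat_def by metis
  then have "\<psi> = r B" using \<psi> by (metis comp_assoc comp_id id_comp)
  then show ?thesis using AB(2) G(3) by blast
qed

subsection \<open>Products\<close>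

definition block_diag :: "nat \<Rightarrow> nat \<Rightarrow> 'a::zero mat \<Rightarrow> 'a mat \<Rightarrow> 'a mat" where
  "block_diag n m A B = four_block_mat A (0\<^sub>m n m) (0\<^sub>m m n) B"

definition block :: "nat \<Rightarrow> nat \<Rightarrow> 'a mat \<Rightarrow> 'a mat" where
  "block k n M = mat n n (\<lambda>(i, j). M $$ (k + i, k + j))"

lemma block_carrier [simp]: "block k n M \<in> carrier_mat n n"
  and block_dim [simp]: "dim_row (block k n M) = n" "dim_col (block k n M) = n"
  and block_entry [simp]: "i < n \<Longrightarrow> j < n \<Longrightarrow> block k n M $$ (i, j) = M $$ (k + i, k + j)"
  by (simp_all add: block_def)

lemma block_one: "k + n \<le> N \<Longrightarrow> block k n (1\<^sub>m N) = 1\<^sub>m n"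
  by (rule eq_matI) (auto simp: block_def)

lemma block_mult:
  fixes M M' :: "'a::semiring_0 mat"
  assumes "M \<in> carrier_mat N N" "M' \<in> carrier_mat N N" "k + n \<le> N"
    and outside: "\<And>i j l. i < n \<Longrightarrow> j < n \<Longrightarrow> l < N \<Longrightarrow> l \<notin> {k..<k + n} \<Longrightarrow>
      M $$ (k + i, l) * M' $$ (l, k + j) = 0"
  shows "block k n (M * M') = block k n M * block k n M'"
proof (rule eq_matI)
  fix i j assume "i < dim_row (block k n M * block k n M')"
    "j < dim_col (block k n M * block k n M')"
  then have ij: "i < n" "j < n" by (simp_all add: block_def)
  have "block k n (M * M') $$ (i, j) = (\<Sum>l\<in>{0..<N}. M $$ (k + i, l) * M' $$ (l, k + j))"
    using ij assms(1-3) by (simp add: scalar_prod_def)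
  also have "\<dots> = (\<Sum>l\<in>{0 + k..<n + k}. M $$ (k + i, l) * M' $$ (l, k + j))"
    using assms(3) outside[OF ij] by (intro sum.mono_neutral_right) (auto simp: add.commute)
  also have "\<dots> = (block k n M * block k n M') $$ (i, j)"
    unfolding sum.shift_bounds_nat_ivl using ij by (simp add: scalar_prod_def block_def add.commute)
  finally show "block k n (M * M') $$ (i, j) = (block k n M * block k n M') $$ (i, j)" .
qed (simp_all add: block_def)

lemma invertible_mat_block:
  fixes M :: "'a::semiring_1 mat"
  assumes M: "M \<in> carrier_mat N N" "invertible_mat M" and k: "k + n \<le> N"
    and outside: "\<And>i l. i < n \<Longrightarrow> l < N \<Longrightarrow> l \<notin> {k..<k + n} \<Longrightarrow> M $$ (k + i, l) = 0 \<and> M $$ (l, k + i) = 0"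
  shows "invertible_mat (block k n M)"
proof -
  obtain M' where M': "M' \<in> carrier_mat N N" "M * M' = 1\<^sub>m N" "M' * M = 1\<^sub>m N"
    using invertible_matE[OF M(2,1)] .
  show ?thesis
  proof (rule invertible_matI)
    show "block k n M * block k n M' = 1\<^sub>m n"
      using block_mult[OF M(1) M'(1) k] outside by (simp add: M'(2) block_one[OF k])
    show "block k n M' * block k n M = 1\<^sub>m n"
      using block_mult[OF M'(1) M(1) k] outside by (simp add: M'(3) block_one[OF k])
  qed simp_all
qed

lemma block_diag_mult:
  fixes A A' B B' :: "'a::semiring_0 mat"
  assumes "A \<in> carrier_mat n n" "A' \<in> carrier_mat n n" "B \<in> carrier_mat m m" "B' \<in> carrier_mat m m"
  shows "block_diag n m A B * block_diag n m A' B' = block_diag n m (A * A') (B * B')"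
  unfolding block_diag_def
  using assms mult_four_block_mat[of A n n "0\<^sub>m n m" m "0\<^sub>m m n" m B A' n "0\<^sub>m n m" m "0\<^sub>m m n" B']
  by simp

lemma block_diag_carrier:
  "A \<in> carrier_mat n n \<Longrightarrow> B \<in> carrier_mat m m \<Longrightarrow> block_diag n m A B \<in> carrier_mat (n + m) (n + m)"
  by (simp add: block_diag_def)

lemma block_block_diag:
  assumes "A \<in> carrier_mat n n" "B \<in> carrier_mat m m"
  shows "block 0 n (block_diag n m A B) = A" "block n m (block_diag n m A B) = B"
  using assms by (auto simp: block_diag_def intro!: eq_matI)

lemma block_diag_entry_outside:
  assumes "A \<in> carrier_mat n n" "B \<in> carrier_mat m m" "i < n" "n \<le> j" "j < n + m"
  shows "block_diag n m A B $$ (i, j) = 0" "block_diag n m A B $$ (j, i) = 0"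
  using assms by (auto simp: block_diag_def)

lemma block_diag_blocks:
  assumes "M \<in> carrier_mat (n + m) (n + m)"
    and "\<And>i j. i < n \<Longrightarrow> n \<le> j \<Longrightarrow> j < n + m \<Longrightarrow> M $$ (i, j) = 0 \<and> M $$ (j, i) = 0"
  shows "M = block_diag n m (block 0 n M) (block n m M)"
  using assms by (intro eq_matI) (auto simp: block_diag_def block_def)

lemma polyfun_block:
  assumes "P \<in> polyfun n" "k + n \<le> N" shows "(\<lambda>M. P (block k n M)) \<in> polyfun N"
  using assms(1)
proof induction
  case (entry i j)
  then have "(\<lambda>M. M $$ (k + i, k + j)) \<in> polyfun N" using assms(2) by (intro polyfun.entry) auto
  then show ?case using entry by simp
qed (auto intro: polyfun.intros)

lemma filterlim_block:
  assumes "\<And>M. M \<in> G \<Longrightarrow> block k n M \<in> G'" "k + n \<le> N"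
  shows "filterlim (block k n) (mat_nhds n G' (block k n M)) (mat_nhds N G M)"
  unfolding filterlim_iff eventually_mat_nhds
proof (intro allI impI, elim exE conjE)
  fix P \<delta> assume "\<delta> > 0"
    and P: "\<forall>B\<in>G'. (\<forall>i<n. \<forall>j<n. cmod (B $$ (i, j) - block k n M $$ (i, j)) < \<delta>) \<longrightarrow> P B"
  have "P (block k n B)" if "B \<in> G" "\<forall>i<N. \<forall>j<N. cmod (B $$ (i, j) - M $$ (i, j)) < \<delta>" for B
    using that P assms by simp
  with \<open>\<delta> > 0\<close> show "\<exists>\<delta>>0. \<forall>B\<in>G.
      (\<forall>i<N. \<forall>j<N. cmod (B $$ (i, j) - M $$ (i, j)) < \<delta>) \<longrightarrow> P (block k n B)"
    by blast
qed

definition block_diag_group ::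
  "nat \<Rightarrow> nat \<Rightarrow> complex mat set \<Rightarrow> complex mat set \<Rightarrow> complex mat set" where
  "block_diag_group n m G H = {block_diag n m A B | A B. A \<in> G \<and> B \<in> H}"

definition block_diag_equations ::
  "nat \<Rightarrow> nat \<Rightarrow> (complex mat \<Rightarrow> complex) set \<Rightarrow> (complex mat \<Rightarrow> complex) set \<Rightarrow>
    (complex mat \<Rightarrow> complex) set" where
  "block_diag_equations n m S T =
    (\<lambda>P M. P (block 0 n M)) ` S \<union> (\<lambda>P M. P (block n m M)) ` T \<union>
    (\<lambda>(i, j) M. M $$ (i, j)) ` ({..<n} \<times> {n..<n + m}) \<union>
    (\<lambda>(i, j) M. M $$ (i, j)) ` ({n..<n + m} \<times> {..<n})"

lemma block_diag_equations_polyfun: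
  assumes "S \<subseteq> polyfun n" "T \<subseteq> polyfun m"
  shows "block_diag_equations n m S T \<subseteq> polyfun (n + m)"
proof -
  have "(\<lambda>M. P (block 0 n M)) \<in> polyfun (n + m)" if "P \<in> S" for P
    using assms(1) that by (intro polyfun_block) auto
  moreover have "(\<lambda>M. P (block n m M)) \<in> polyfun (n + m)" if "P \<in> T" for P
    using assms(2) that by (intro polyfun_block) auto
  ultimately show ?thesis unfolding block_diag_equations_def by (auto intro!: polyfun.entry)
qed

lemma block_diag_equations_vanish_iff:
  "(\<forall>P\<in>block_diag_equations n m S T. P M = 0) \<longleftrightarrow>
    (\<forall>P\<in>S. P (block 0 n M) = 0) \<and> (\<forall>P\<in>T. P (block n m M) = 0) \<and>
    (\<forall>i<n. \<forall>j\<in>{n..<n + m}. M $$ (i, j) = 0 \<and> M $$ (j, i) = 0)"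
  unfolding block_diag_equations_def ball_Un by auto

lemma block_diag_groupE:
  assumes "M \<in> block_diag_group n m G H"
  obtains A B where "M = block_diag n m A B" "A \<in> G" "B \<in> H"
  using assms unfolding block_diag_group_def by blast

lemma block_diag_group_carrier:
  assumes "G \<subseteq> carrier_mat n n" "H \<subseteq> carrier_mat m m"
  shows "block_diag_group n m G H \<subseteq> carrier_mat (n + m) (n + m)"
  using assms block_diag_carrier unfolding block_diag_group_def by blast

lemma block_diag_group_mult:
  assumes G: "abelian_linear_algebraic_group n G" and H: "abelian_linear_algebraic_group m H"
    and M: "M \<in> block_diag_group n m G H" and M': "M' \<in> block_diag_group n m G H"
  shows "M * M' \<in> block_diag_group n m G H" "M * M' = M' * M"
proof -
  obtain A B where AB: "M = block_diag n m A B" "A \<in> G" "B \<in> H"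
    using M by (rule block_diag_groupE)
  obtain A' B' where AB': "M' = block_diag n m A' B'" "A' \<in> G" "B' \<in> H"
    using M' by (rule block_diag_groupE)
  note carrier = abelian_linear_algebraic_group_carrier[OF G]
    abelian_linear_algebraic_group_carrier[OF H]
  have "M * M' = block_diag n m (A * A') (B * B')" "M' * M = block_diag n m (A' * A) (B' * B)"
    unfolding AB(1) AB'(1) using AB AB' carrier by (simp_all add: block_diag_mult)
  moreover have "A * A' \<in> G" "B * B' \<in> H" "A * A' = A' * A" "B * B' = B' * B"
    using AB AB' G H abelian_linear_algebraic_group_mult abelian_linear_algebraic_group_commute
    by blast+
  ultimately show "M * M' \<in> block_diag_group n m G H" "M * M' = M' * M"
    unfolding block_diag_group_def by auto
qed

lemma block_diag_group_one:
  assumes "1\<^sub>m n \<in> G" "1\<^sub>m m \<in> H" shows "1\<^sub>m (n + m) \<in> block_diag_group n m G H"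
proof -
  have "1\<^sub>m (n + m) = block_diag n m (1\<^sub>m n) (1\<^sub>m m :: complex mat)" by (simp add: block_diag_def)
  then show ?thesis using assms unfolding block_diag_group_def by blast
qed

lemma block_diag_group_inverse:
  assumes G: "abelian_linear_algebraic_group n G" and H: "abelian_linear_algebraic_group m H"
    and M: "M \<in> block_diag_group n m G H"
  shows "\<exists>M'\<in>block_diag_group n m G H. M * M' = 1\<^sub>m (n + m)"
proof -
  obtain A B where AB: "M = block_diag n m A B" "A \<in> G" "B \<in> H"
    using M by (rule block_diag_groupE)
  obtain A' B' where AB': "A' \<in> G" "A * A' = 1\<^sub>m n" "B' \<in> H" "B * B' = 1\<^sub>m m"
    using abelian_linear_algebraic_group_inverse[OF G AB(2)]
      abelian_linear_algebraic_group_inverse[OF H AB(3)] by blast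
  note carrier = abelian_linear_algebraic_group_carrier[OF G]
    abelian_linear_algebraic_group_carrier[OF H]
  have "M * block_diag n m A' B' = block_diag n m (1\<^sub>m n) (1\<^sub>m m)"
    unfolding AB(1) AB'(2,4)[symmetric] using AB AB' carrier by (intro block_diag_mult) auto
  then have "M * block_diag n m A' B' = 1\<^sub>m (n + m)" by (simp add: block_diag_def)
  then show ?thesis using AB' unfolding block_diag_group_def by blast
qed

lemma block_diag_group_eq_zero_locus:
  assumes G: "G = {A \<in> carrier_mat n n. invertible_mat A \<and> (\<forall>P\<in>S. P A = 0)}"
    and H: "H = {B \<in> carrier_mat m m. invertible_mat B \<and> (\<forall>P\<in>T. P B = 0)}"
  shows "M \<in> block_diag_group n m G H \<Longrightarrow> \<forall>P\<in>block_diag_equations n m S T. P M = 0"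
    and "M \<in> carrier_mat (n + m) (n + m) \<Longrightarrow> invertible_mat M \<Longrightarrow>
      \<forall>P\<in>block_diag_equations n m S T. P M = 0 \<Longrightarrow> M \<in> block_diag_group n m G H"
proof -
  assume "M \<in> block_diag_group n m G H"
  then obtain A B where AB: "M = block_diag n m A B" "A \<in> G" "B \<in> H" by (rule block_diag_groupE)
  then have carrier: "A \<in> carrier_mat n n" "B \<in> carrier_mat m m"
    and zero: "\<forall>P\<in>S. P A = 0" "\<forall>P\<in>T. P B = 0"
    unfolding G H by blast+
  show "\<forall>P\<in>block_diag_equations n m S T. P M = 0"
    unfolding block_diag_equations_vanish_iff AB(1) block_block_diag[OF carrier]
    by (simp add: zero block_diag_entry_outside[OF carrier])
next
  assume M: "M \<in> carrier_mat (n + m) (n + m)" "invertible_mat M"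
    and "\<forall>P\<in>block_diag_equations n m S T. P M = 0"
  then have zero: "\<forall>P\<in>S. P (block 0 n M) = 0" "\<forall>P\<in>T. P (block n m M) = 0"
    and outside: "\<And>i j. i < n \<Longrightarrow> n \<le> j \<Longrightarrow> j < n + m \<Longrightarrow> M $$ (i, j) = 0 \<and> M $$ (j, i) = 0"
    unfolding block_diag_equations_vanish_iff by simp_all
  have "invertible_mat (block 0 n M)" "invertible_mat (block n m M)"
    by (rule invertible_mat_block[OF M]; use outside in simp)+
  then have "block 0 n M \<in> G" "block n m M \<in> H" using zero unfolding G H by simp_all
  then show "M \<in> block_diag_group n m G H"
    unfolding block_diag_group_def using block_diag_blocks[OF M(1) outside] by blast
qed

lemma abelian_linear_algebraic_group_block_diag:
  assumes G: "abelian_linear_algebraic_group n G" and H: "abelian_linear_algebraic_group m H"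
  shows "abelian_linear_algebraic_group (n + m) (block_diag_group n m G H)"
proof -
  obtain S T
    where S: "S \<subseteq> polyfun n" "G = {A \<in> carrier_mat n n. invertible_mat A \<and> (\<forall>P\<in>S. P A = 0)}"
      and T: "T \<subseteq> polyfun m" "H = {B \<in> carrier_mat m m. invertible_mat B \<and> (\<forall>P\<in>T. P B = 0)}"
    using G H unfolding abelian_linear_algebraic_group_def by blast
  note equations = block_diag_equations_polyfun[OF S(1) T(1)]
  note zero_locus = block_diag_group_eq_zero_locus[OF S(2) T(2)]
  show ?thesis
  proof (rule abelian_linear_algebraic_groupI[OF _ _ _ _ _ equations])
    show "block_diag_group n m G H \<subseteq> carrier_mat (n + m) (n + m)"
      by (rule block_diag_group_carrier) (auto simp: S(2) T(2))
    show "1\<^sub>m (n + m) \<in> block_diag_group n m G H"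
      by (intro block_diag_group_one abelian_linear_algebraic_group_one G H)
    show "P M = 0" if "M \<in> block_diag_group n m G H" "P \<in> block_diag_equations n m S T" for M P
      using zero_locus(1)[OF that(1)] that(2) by (rule bspec)
    show "M \<in> block_diag_group n m G H"
      if "M \<in> carrier_mat (n + m) (n + m)" "invertible_mat M"
        "\<And>P. P \<in> block_diag_equations n m S T \<Longrightarrow> P M = 0" for M
      using that by (intro zero_locus(2) ballI)
  qed (rule block_diag_group_mult[OF G H] block_diag_group_inverse[OF G H]; assumption)+
qed

definition block_action ::
  "nat \<Rightarrow> nat \<Rightarrow> (complex mat \<Rightarrow> 'b \<Rightarrow> 'b) \<Rightarrow> (complex mat \<Rightarrow> 'b \<Rightarrow> 'b) \<Rightarrow> complex mat \<Rightarrow> 'b \<Rightarrow> 'b" where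
  "block_action n m r s M = r (block 0 n M) \<circ> s (block n m M)"

lemma block_action_block_diag:
  "A \<in> carrier_mat n n \<Longrightarrow> B \<in> carrier_mat m m \<Longrightarrow>
    block_action n m r s (block_diag n m A B) = r A \<circ> s B"
  by (simp add: block_action_def block_block_diag)

lemma block_diag_group_block:
  assumes "G \<subseteq> carrier_mat n n" "H \<subseteq> carrier_mat m m" "M \<in> block_diag_group n m G H"
  shows "block 0 n M \<in> G" "block n m M \<in> H"
  using assms by (auto elim!: block_diag_groupE simp: block_block_diag subset_iff)

lemma tendsto_jet_entry_block_action:
  assumes r: "lie_hom_mat n G r" "G \<subseteq> carrier_mat n n"
    and s: "lie_hom_mat m H s" "H \<subseteq> carrier_mat m m"
    and M: "M \<in> block_diag_group n m G H"
  shows "((\<lambda>M. jet_entry (block_action n m r s M) \<alpha> \<beta>) \<longlongrightarrow> jet_entry (block_action n m r s M) \<alpha> \<beta>)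
    (mat_nhds (n + m) (block_diag_group n m G H) M)"
proof -
  let ?\<F> = "mat_nhds (n + m) (block_diag_group n m G H) M"
  note block = block_diag_group_block[OF r(2) s(2)]
  have expand: "jet_entry (block_action n m r s M) \<alpha> \<beta> = (\<Sum>\<gamma> | mdeg \<gamma> \<le> mdeg \<alpha>.
      jet_entry (s (block n m M)) \<gamma> \<beta> * jet_entry (r (block 0 n M)) \<alpha> \<gamma>)"
    if "M \<in> block_diag_group n m G H" for M
    unfolding block_action_def using r(1) block(1)[OF that]
    by (intro jet_entry_comp formal_diff_filtered) (auto simp: lie_hom_mat_iff)
  have "((\<lambda>M. jet_entry (r (block 0 n M)) \<alpha> \<beta>) \<longlongrightarrow> jet_entry (r (block 0 n M)) \<alpha> \<beta>) ?\<F>" for \<alpha> \<beta>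
    by (rule filterlim_compose[OF lie_hom_mat_tendsto[OF r(1) block(1)[OF M]] filterlim_block])
      (use block in auto)
  moreover have "((\<lambda>M. jet_entry (s (block n m M)) \<alpha> \<beta>) \<longlongrightarrow> jet_entry (s (block n m M)) \<alpha> \<beta>) ?\<F>"
    for \<alpha> \<beta>
    by (rule filterlim_compose[OF lie_hom_mat_tendsto[OF s(1) block(2)[OF M]] filterlim_block])
      (use block in auto)
  ultimately have lim: "((\<lambda>M. \<Sum>\<gamma> | mdeg \<gamma> \<le> mdeg \<alpha>. jet_entry (s (block n m M)) \<gamma> \<beta> *
      jet_entry (r (block 0 n M)) \<alpha> \<gamma>) \<longlongrightarrow> jet_entry (block_action n m r s M) \<alpha> \<beta>) ?\<F>"
    unfolding expand[OF M] by (intro tendsto_sum tendsto_mult)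
  show ?thesis
    by (rule Lim_transform_eventually[OF lim eventually_mat_nhdsI]) (simp add: expand)
qed

lemma lie_hom_mat_block_action:
  assumes G: "abelian_linear_algebraic_group n G" "lie_hom_mat n G r"
    and H: "abelian_linear_algebraic_group m H" "lie_hom_mat m H s"
    and commute: "\<And>A B. A \<in> G \<Longrightarrow> B \<in> H \<Longrightarrow> r A \<circ> s B = s B \<circ> r A"
  shows "lie_hom_mat (n + m) (block_diag_group n m G H) (block_action n m r s)"
proof -
  have carrier: "G \<subseteq> carrier_mat n n" "H \<subseteq> carrier_mat m m"
    using abelian_linear_algebraic_group_carrier G(1) H(1) by blast+
  have action: "block_action n m r s (block_diag n m A B) = r A \<circ> s B" if "A \<in> G" "B \<in> H" for A B
    using that carrier by (intro block_action_block_diag) auto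
  have "block_action n m r s M \<in> formal_diff" if "M \<in> block_diag_group n m G H" for M
    using block_diag_group_block[OF carrier that] G(2) H(2)
    unfolding block_action_def by (intro formal_diff_comp) (auto simp: lie_hom_mat_def)
  moreover have "block_action n m r s (M * M') = block_action n m r s M \<circ> block_action n m r s M'"
    if M: "M \<in> block_diag_group n m G H" and M': "M' \<in> block_diag_group n m G H" for M M'
  proof -
    obtain A B where AB: "M = block_diag n m A B" "A \<in> G" "B \<in> H"
      using M by (rule block_diag_groupE)
    obtain A' B' where AB': "M' = block_diag n m A' B'" "A' \<in> G" "B' \<in> H"
      using M' by (rule block_diag_groupE)
    have "M * M' = block_diag n m (A * A') (B * B')"
      unfolding AB(1) AB'(1) using AB AB' carrier by (intro block_diag_mult) auto
    then have "block_action n m r s (M * M') = r (A * A') \<circ> s (B * B')"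
      using G(1) H(1) AB AB' by (simp only: action abelian_linear_algebraic_group_mult)
    also have "\<dots> = r A \<circ> (r A' \<circ> s B) \<circ> s B'"
      using G(2) H(2) AB AB' by (simp add: lie_hom_mat_def comp_assoc)
    also have "r A' \<circ> s B = s B \<circ> r A'" by (rule commute[OF AB'(2) AB(3)])
    finally show ?thesis using AB AB' action by (metis comp_assoc)
  qed
  ultimately show ?thesis
    unfolding lie_hom_mat_iff
    using tendsto_jet_entry_block_action[OF G(2) carrier(1) H(2) carrier(2)] by blast
qed

lemma algebraic_diff_group_product:
  assumes H: "algebraic_diff_group H" and K: "algebraic_diff_group K"
    and commute: "\<And>\<phi> \<psi>. \<phi> \<in> H \<Longrightarrow> \<psi> \<in> K \<Longrightarrow> \<phi> \<circ> \<psi> = \<psi> \<circ> \<phi>"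
  shows "algebraic_diff_group {\<phi> \<circ> \<psi> | \<phi> \<psi>. \<phi> \<in> H \<and> \<psi> \<in> K}"
proof -
  obtain n G r where G: "abelian_linear_algebraic_group n G" "lie_hom_mat n G r" "r ` G = H"
    using H by (rule algebraic_diff_groupE)
  obtain m L s where L: "abelian_linear_algebraic_group m L" "lie_hom_mat m L s" "s ` L = K"
    using K by (rule algebraic_diff_groupE)
  have action: "block_action n m r s (block_diag n m A B) = r A \<circ> s B" if "A \<in> G" "B \<in> L" for A B
    using that G(1) L(1) by (intro block_action_block_diag abelian_linear_algebraic_group_carrier)
  have "block_action n m r s ` block_diag_group n m G L = {r A \<circ> s B | A B. A \<in> G \<and> B \<in> L}"
    unfolding block_diag_group_def by (force simp: action)
  also have "\<dots> = {\<phi> \<circ> \<psi> | \<phi> \<psi>. \<phi> \<in> H \<and> \<psi> \<in> K}" using G(3) L(3) by blast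
  finally have "block_action n m r s ` block_diag_group n m G L = {\<phi> \<circ> \<psi> | \<phi> \<psi>. \<phi> \<in> H \<and> \<psi> \<in> K}" .
  moreover have "lie_hom_mat (n + m) (block_diag_group n m G L) (block_action n m r s)"
    using commute G(3) L(3) by (intro lie_hom_mat_block_action G(1,2) L(1,2)) blast
  ultimately show ?thesis
    unfolding algebraic_diff_group_def
    using abelian_linear_algebraic_group_block_diag[OF G(1) L(1)] by blast
qed

subsection \<open>One-parameter groups\<close>

definition shear :: "complex \<Rightarrow> complex mat" where
  "shear z = mat 2 2 (\<lambda>(i, j). if i = j then 1 else if i = 0 then z else 0)"

lemma shear_carrier: "shear z \<in> carrier_mat 2 2"
  and shear_entry: "shear z $$ (0, Suc 0) = z"
  by (simp_all add: shear_def)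

lemma shear_mult: "shear z * shear w = shear (z + w)"
  by (rule eq_matI) (auto simp: shear_def scalar_prod_def numeral_2_eq_2 less_Suc_eq)

lemma shear_0: "shear 0 = 1\<^sub>m 2"
  by (rule eq_matI) (auto simp: shear_def)

lemma abelian_linear_algebraic_group_shear: "abelian_linear_algebraic_group 2 (range shear)"
proof (rule abelian_linear_algebraic_groupI)
  let ?S = "{\<lambda>A. A $$ (0, 0) - 1, \<lambda>A. A $$ (Suc 0, Suc 0) - 1, \<lambda>A. A $$ (Suc 0, 0)}"
  show "?S \<subseteq> polyfun 2" by (auto intro!: polyfun_minus polyfun.entry polyfun.const)
  show "P A = 0" if "A \<in> range shear" "P \<in> ?S" for A P using that by (auto simp: shear_def)
  show "A \<in> range shear" if A: "A \<in> carrier_mat 2 2" and zero: "\<And>P. P \<in> ?S \<Longrightarrow> P A = 0" for A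
  proof -
    have "A $$ (0, 0) - 1 = 0" "A $$ (Suc 0, Suc 0) - 1 = 0" "A $$ (Suc 0, 0) = 0"
      by (rule zero[of "\<lambda>A. A $$ (0, 0) - 1"] zero[of "\<lambda>A. A $$ (Suc 0, Suc 0) - 1"]
          zero[of "\<lambda>A. A $$ (Suc 0, 0)"]; simp)+
    then have "A = shear (A $$ (0, Suc 0))"
      using A by (intro eq_matI) (auto simp: shear_def less_2_cases_iff)
    then show ?thesis by blast
  qed
  show "\<exists>B\<in>range shear. A * B = 1\<^sub>m 2" if "A \<in> range shear" for A
  proof -
    from that obtain z where "A = shear z" ..
    then have "A * shear (- z) = 1\<^sub>m 2" by (simp add: shear_mult shear_0)
    then show ?thesis by blast
  qed
  show "range shear \<subseteq> carrier_mat 2 2" using shear_carrier by blast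
  show "1\<^sub>m 2 \<in> range shear" unfolding shear_0[symmetric] by (rule rangeI)
  show "A * B \<in> range shear" "A * B = B * A" if "A \<in> range shear" "B \<in> range shear" for A B
    using that by (auto simp: shear_mult add.commute)
qed

lemma algebraic_diff_group_one_parameter:
  fixes g :: "complex \<Rightarrow> 'n::finite fps_n \<Rightarrow> 'n fps_n"
  assumes "\<And>z. g z \<in> formal_diff" "\<And>z w. g (z + w) = g z \<circ> g w"
    and "\<And>\<alpha> \<beta>. continuous_on UNIV (\<lambda>z. jet_entry (g z) \<alpha> \<beta>)"
  shows "algebraic_diff_group (range g)"
proof -
  define r where "r = (\<lambda>A :: complex mat. g (A $$ (0, Suc 0)))"
  have r: "r (shear z) = g z" for z by (simp add: r_def shear_entry)
  have "lie_hom_mat 2 (range shear) r"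
    unfolding lie_hom_mat_iff
  proof (intro conjI allI ballI)
    show "((\<lambda>B. jet_entry (r B) \<alpha> \<beta>) \<longlongrightarrow> jet_entry (r A) \<alpha> \<beta>) (mat_nhds 2 (range shear) A)" for \<alpha> \<beta> A
      unfolding r_def
      by (rule continuous_on_tendsto_compose[OF assms(3)]) (auto intro: tendsto_mat_entry)
  qed (use assms(1,2) in \<open>auto simp: shear_mult r\<close>)
  moreover have "r ` range shear = range g" by (simp add: image_image r)
  ultimately show ?thesis
    using abelian_linear_algebraic_group_shear unfolding algebraic_diff_group_def by blast
qed

lemma (in unipotent) algebraic_diff_group_upow: "algebraic_diff_group (range upow)"
proof (rule algebraic_diff_group_one_parameter)
  show "continuous_on UNIV (\<lambda>z. jet_entry (upow z) \<alpha> \<beta>)" for \<alpha> \<beta>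
  proof -
    obtain P where "\<And>z. jet_entry (upow z) \<alpha> \<beta> = poly P z"
      using is_poly_upow[of "fps_n_monom \<beta>" \<alpha>] unfolding is_poly_def jet_entry_def by blast
    then show ?thesis using continuous_on_poly[OF continuous_on_id, of UNIV P] by simp
  qed
qed (simp_all add: upow_formal_diff upow_add)

section \<open>Character groups of finitely generated monoids\<close>

definition eval_monom :: "nat \<Rightarrow> (nat \<Rightarrow> complex) \<Rightarrow> (nat \<Rightarrow> nat) \<Rightarrow> complex" where
  "eval_monom d t a = (\<Prod>j<d. t j ^ a j)"

lemma eval_monom_mult: "eval_monom d (\<lambda>j. s j * t j) a = eval_monom d s a * eval_monom d t a"
  by (simp add: eval_monom_def power_mult_distrib prod.distrib)

lemma eval_monom_inverse: "eval_monom d (\<lambda>j. inverse (t j)) a = inverse (eval_monom d t a)"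
  by (simp add: eval_monom_def power_inverse prod_inversef[symmetric] comp_def)

lemma eval_monom_add: "eval_monom d t (\<lambda>j. a j + b j) = eval_monom d t a * eval_monom d t b"
  by (simp add: eval_monom_def power_add prod.distrib)

lemma eval_monom_0: "eval_monom d t (\<lambda>_. 0) = 1"
  by (simp add: eval_monom_def)

lemma eval_monom_nonzero: "(\<And>j. j < d \<Longrightarrow> t j \<noteq> 0) \<Longrightarrow> eval_monom d t a \<noteq> 0"
  by (simp add: eval_monom_def)

lemma eval_monom_unit: "i < d \<Longrightarrow> eval_monom d t (\<lambda>j. if j = i then 1 else 0) = t i"
  by (simp add: eval_monom_def if_distrib prod.delta cong: if_cong)

lemma eval_monom_cong: "(\<And>j. j < d \<Longrightarrow> s j = t j) \<Longrightarrow> eval_monom d s = eval_monom d t"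
  unfolding eval_monom_def by (intro ext prod.cong) auto

lemma tendsto_eval_monom:
  assumes "\<And>j. j < d \<Longrightarrow> ((\<lambda>x. T x j) \<longlongrightarrow> t j) \<F>"
  shows "((\<lambda>x. eval_monom d (T x) a) \<longlongrightarrow> eval_monom d t a) \<F>"
  unfolding eval_monom_def using assms by (intro tendsto_prod tendsto_power) auto

text \<open>A point \<open>t\<close> stands for the character \<open>l j \<mapsto> t j\<close> of the monoid generated by
  \<open>l 0, \<dots>, l (d - 1)\<close>.\<close>

definition character_torus :: "nat \<Rightarrow> (nat \<Rightarrow> complex) \<Rightarrow> (nat \<Rightarrow> complex) set" where
  "character_torus d l = {t. (\<forall>j<d. t j \<noteq> 0) \<and>
     (\<forall>a b. eval_monom d l a = eval_monom d l b \<longrightarrow> eval_monom d t a = eval_monom d t b)}"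

lemma character_torus_nonzero: "t \<in> character_torus d l \<Longrightarrow> j < d \<Longrightarrow> t j \<noteq> 0"
  and character_torus_relation:
    "t \<in> character_torus d l \<Longrightarrow> eval_monom d l a = eval_monom d l b \<Longrightarrow>
      eval_monom d t a = eval_monom d t b"
  unfolding character_torus_def by blast+

lemma character_torus_one: "(\<lambda>_. 1) \<in> character_torus d l"
  by (simp add: character_torus_def eval_monom_def)

lemma character_torus_mult:
  "s \<in> character_torus d l \<Longrightarrow> t \<in> character_torus d l \<Longrightarrow> (\<lambda>j. s j * t j) \<in> character_torus d l"
  unfolding character_torus_def mem_Collect_eq eval_monom_mult by (metis mult_eq_0_iff)

lemma character_torus_inverse:
  "t \<in> character_torus d l \<Longrightarrow> (\<lambda>j. inverse (t j)) \<in> character_torus d l"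
  unfolding character_torus_def mem_Collect_eq eval_monom_inverse by (metis inverse_zero_imp_zero)

definition diagonal :: "'a mat \<Rightarrow> nat \<Rightarrow> 'a" where
  "diagonal A = (\<lambda>j. A $$ (j, j))"

lemma diagonal_mat_diag: "j < d \<Longrightarrow> diagonal (mat_diag d t) j = t j"
  by (simp add: diagonal_def mat_diag_def)

lemma mat_diag_cong: "(\<And>j. j < d \<Longrightarrow> s j = t j) \<Longrightarrow> mat_diag d s = mat_diag d t"
  by (rule eq_matI) (auto simp: mat_diag_def)

lemma mat_diag_invertible_nonzero:
  fixes t :: "nat \<Rightarrow> 'a::semiring_1"
  assumes "invertible_mat (mat_diag d t)" "j < d" shows "t j \<noteq> 0"
proof -
  obtain B where B: "B \<in> carrier_mat d d" "mat_diag d t * B = 1\<^sub>m d"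
    using invertible_matE[OF assms(1) mat_diag_dim] .
  have "t j * B $$ (j, j) = (mat_diag d t * B) $$ (j, j)"
    using B(1) assms(2) by (simp add: mat_diag_mult_left)
  also have "\<dots> = 1" using assms(2) by (simp add: B(2))
  finally show ?thesis by auto
qed

definition character_torus_equations :: "nat \<Rightarrow> (nat \<Rightarrow> complex) \<Rightarrow> (complex mat \<Rightarrow> complex) set" where
  "character_torus_equations d l =
    (\<lambda>(i, j) A. A $$ (i, j)) ` {(i, j). i < d \<and> j < d \<and> i \<noteq> j} \<union>
    (\<lambda>(a, b) A. eval_monom d (diagonal A) a - eval_monom d (diagonal A) b) `
      {(a, b). eval_monom d l a = eval_monom d l b}"

lemma character_torus_equations_polyfun: "character_torus_equations d l \<subseteq> polyfun d"
proof -
  have "(\<lambda>A. eval_monom d (diagonal A) a) \<in> polyfun d" for a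
    unfolding eval_monom_def diagonal_def by (intro polyfun_prod polyfun_power polyfun.entry) auto
  then show ?thesis
    unfolding character_torus_equations_def by (auto intro!: polyfun_minus polyfun.entry)
qed

lemma character_torus_equations_vanish_iff:
  "(\<forall>P\<in>character_torus_equations d l. P A = 0) \<longleftrightarrow>
    (\<forall>i<d. \<forall>j<d. i \<noteq> j \<longrightarrow> A $$ (i, j) = 0) \<and>
    (\<forall>a b. eval_monom d l a = eval_monom d l b \<longrightarrow>
      eval_monom d (diagonal A) a = eval_monom d (diagonal A) b)"
  unfolding character_torus_equations_def ball_Un by auto

lemma character_torus_equations_mat_diag:
  assumes "t \<in> character_torus d l" "P \<in> character_torus_equations d l"
  shows "P (mat_diag d t) = 0"
proof -
  have diagonal: "eval_monom d (diagonal (mat_diag d t)) = eval_monom d t"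
    by (rule eval_monom_cong[OF diagonal_mat_diag])
  have off: "mat_diag d t $$ (i, j) = 0" if "i < d" "j < d" "i \<noteq> j" for i j
    using that by (simp add: mat_diag_def)
  have "\<forall>P\<in>character_torus_equations d l. P (mat_diag d t) = 0"
    unfolding character_torus_equations_vanish_iff diagonal
    by (intro conjI allI impI off character_torus_relation[OF assms(1)])
  then show ?thesis using assms(2) by (rule bspec)
qed

lemma mat_diag_character_torusI:
  assumes A: "A \<in> carrier_mat d d" "invertible_mat A"
    and zero: "\<And>P. P \<in> character_torus_equations d l \<Longrightarrow> P A = 0"
  shows "A \<in> mat_diag d ` character_torus d l"
proof -
  have "\<forall>P\<in>character_torus_equations d l. P A = 0" by (intro ballI zero)
  then have off: "\<forall>i<d. \<forall>j<d. i \<noteq> j \<longrightarrow> A $$ (i, j) = 0"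
    and relation: "\<forall>a b. eval_monom d l a = eval_monom d l b \<longrightarrow>
      eval_monom d (diagonal A) a = eval_monom d (diagonal A) b"
    unfolding character_torus_equations_vanish_iff by blast+
  have A_eq: "A = mat_diag d (diagonal A)"
    using A(1) off by (intro eq_matI) (auto simp: mat_diag_def diagonal_def)
  have "diagonal A j \<noteq> 0" if "j < d" for j
    using mat_diag_invertible_nonzero[of d "diagonal A" j] A(2) that
    unfolding A_eq[symmetric] by blast
  then have "diagonal A \<in> character_torus d l"
    unfolding character_torus_def using relation by blast
  with A_eq show ?thesis by (rule image_eqI)
qed

lemma abelian_linear_algebraic_group_character_torus:
  "abelian_linear_algebraic_group d (mat_diag d ` character_torus d l)"
proof (rule abelian_linear_algebraic_groupI[OF _ _ _ _ _ character_torus_equations_polyfun])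
  show "mat_diag d ` character_torus d l \<subseteq> carrier_mat d d" by auto
  show "1\<^sub>m d \<in> mat_diag d ` character_torus d l"
    using imageI[OF character_torus_one, of "mat_diag d"] by simp
  show "A * B \<in> mat_diag d ` character_torus d l" "A * B = B * A"
    if "A \<in> mat_diag d ` character_torus d l" "B \<in> mat_diag d ` character_torus d l" for A B
    using that by (auto intro: character_torus_mult simp: mult.commute)
  show "\<exists>B\<in>mat_diag d ` character_torus d l. A * B = 1\<^sub>m d"
    if A: "A \<in> mat_diag d ` character_torus d l" for A
  proof -
    obtain t where t: "t \<in> character_torus d l" "A = mat_diag d t" using A by blast
    have "mat_diag d t * mat_diag d (\<lambda>j. inverse (t j)) = mat_diag d (\<lambda>_. 1)"
      unfolding mat_diag_diag by (rule mat_diag_cong) (simp add: character_torus_nonzero[OF t(1)])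
    then show ?thesis using character_torus_inverse[OF t(1)] t(2) by auto
  qed
  show "P A = 0"
    if "A \<in> mat_diag d ` character_torus d l" "P \<in> character_torus_equations d l" for A P
    using that character_torus_equations_mat_diag by blast
qed (rule mat_diag_character_torusI)

definition eval_char :: "nat \<Rightarrow> (nat \<Rightarrow> complex) \<Rightarrow> (nat \<Rightarrow> complex) \<Rightarrow> complex \<Rightarrow> complex" where
  "eval_char d l t \<mu> = eval_monom d t (SOME a. eval_monom d l a = \<mu>)"

lemma eval_char_eval_monom:
  assumes "t \<in> character_torus d l"
  shows "eval_char d l t (eval_monom d l a) = eval_monom d t a"
  unfolding eval_char_def
  by (rule character_torus_relation[OF assms])
    (rule someI[of "\<lambda>b. eval_monom d l b = eval_monom d l a" a, OF refl])

lemma eval_char_mult: "eval_char d l (\<lambda>j. s j * t j) \<mu> = eval_char d l s \<mu> * eval_char d l t \<mu>"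
  by (simp add: eval_char_def eval_monom_mult)

lemma eval_char_cong:
  assumes "\<And>j. j < d \<Longrightarrow> s j = t j" shows "eval_char d l s = eval_char d l t"
  using eval_monom_cong[OF assms] by (simp add: eval_char_def fun_eq_iff)

context eigenvalue_monoid
begin

lemma character_eval_char:
  assumes E: "E = range (eval_monom d l)" and t: "t \<in> character_torus d l"
  shows "character (eval_char d l t)"
  unfolding character_def
proof (intro conjI ballI)
  note eval = eval_char_eval_monom[OF t]
  show "eval_char d l t 1 = 1" using eval[of "\<lambda>_. 0"] by (simp add: eval_monom_0)
  show "eval_char d l t (\<mu> * \<nu>) = eval_char d l t \<mu> * eval_char d l t \<nu>"
    if \<mu>\<nu>: "\<mu> \<in> E" "\<nu> \<in> E" for \<mu> \<nu>
  proof -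
    obtain a b where "\<mu> = eval_monom d l a" "\<nu> = eval_monom d l b" using \<mu>\<nu> unfolding E by blast
    then show ?thesis by (simp add: eval flip: eval_monom_add)
  qed
  show "eval_char d l t \<mu> \<noteq> 0" if "\<mu> \<in> E" for \<mu>
    using that eval_monom_nonzero character_torus_nonzero[OF t] unfolding E by (auto simp: eval)
qed

lemma algebraic_diff_group_characters:
  assumes E: "E = range (eval_monom d l)"
  shows "algebraic_diff_group ((\<lambda>t. semisimple (eval_char d l t)) ` character_torus d l)"
proof -
  define r where "r = (\<lambda>A. semisimple (eval_char d l (diagonal A)))"
  have r: "r (mat_diag d t) = semisimple (eval_char d l t)" for t
    using eval_char_cong[OF diagonal_mat_diag] by (simp add: r_def)
  have "lie_hom_mat d (mat_diag d ` character_torus d l) r"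
    unfolding lie_hom_mat_iff
  proof (intro conjI ballI allI)
    show "r ` mat_diag d ` character_torus d l \<subseteq> formal_diff"
      using character_eval_char[OF E] semisimple_formal_diff by (auto simp: r)
    show "r (A * B) = r A \<circ> r B"
      if "A \<in> mat_diag d ` character_torus d l" "B \<in> mat_diag d ` character_torus d l" for A B
      using that by (auto simp: r semisimple_comp eval_char_mult[abs_def])
    show "((\<lambda>B. jet_entry (r B) \<alpha> \<beta>) \<longlongrightarrow> jet_entry (r A) \<alpha> \<beta>) (mat_nhds d G A)" for \<alpha> \<beta> A G
      unfolding r_def jet_entry_semisimple eval_char_def diagonal_def
      by (intro tendsto_sum tendsto_mult tendsto_const tendsto_eval_monom tendsto_mat_entry)
  qed
  moreover have "r ` mat_diag d ` character_torus d l =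
      (\<lambda>t. semisimple (eval_char d l t)) ` character_torus d l"
    by (simp add: image_image r)
  ultimately show ?thesis
    using abelian_linear_algebraic_group_character_torus unfolding algebraic_diff_group_def by blast
qed

sublocale unipotent unipotent_part
  by unfold_locales (rule unipotent_part_formal_diff, rule unipotent_part_nilpotent)

end

lemma formal_diff_eigenvalue_monoid:
  assumes F: "F \<in> formal_diff"
  obtains d l where "\<And>j. j < d \<Longrightarrow> l j \<noteq> 0" "eigenvalue_monoid F (range (eval_monom d l))"
proof -
  obtain P where P: "annihilates_jets F P 2" "0 \<notin> roots P"
    using formal_diff_annihilates_jets[OF F, of 1] by (auto simp: numeral_2_eq_2)
  have "finite (roots P)" using P(1) by (intro poly_roots_finite) (simp add: annihilates_jets_def)
  then obtain d and l :: "nat \<Rightarrow> complex" where l: "roots P = l ` {j. j < d}"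
    using finite_imp_nat_seg_image_inj_on by metis
  have l_nonzero: "l j \<noteq> 0" if "j < d" for j using that l P(2) by force
  have "eigenvalue_monoid F (range (eval_monom d l))"
  proof
    show "F \<in> formal_diff" by (rule F)
    show "1 \<in> range (eval_monom d l)" using eval_monom_0 by (metis rangeI)
    show "\<mu> * \<nu> \<in> range (eval_monom d l)"
      if "\<mu> \<in> range (eval_monom d l)" "\<nu> \<in> range (eval_monom d l)" for \<mu> \<nu>
      using that by (auto simp flip: eval_monom_add)
    show "0 \<notin> range (eval_monom d l)" using eval_monom_nonzero l_nonzero by (metis rangeE)
    have "l j \<in> range (eval_monom d l)" if "j < d" for j
      using eval_monom_unit[OF that, of l] by (metis rangeI)
    then have "roots P \<subseteq> range (eval_monom d l)" unfolding l by blast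
    with P(1) show "\<exists>P. annihilates_jets F P 2 \<and> roots P \<subseteq> range (eval_monom d l)" by blast
  qed
  with l_nonzero show ?thesis by (rule that)
qed

section \<open>Algebraic hulls\<close>

definition commutant :: "('n::finite fps_n \<Rightarrow> 'n fps_n) set \<Rightarrow> ('n fps_n \<Rightarrow> 'n fps_n) set" where
  "commutant X = {\<psi>. filtered \<psi> \<and> (\<forall>\<phi>\<in>X. \<psi> \<circ> \<phi> = \<phi> \<circ> \<psi>)}"

lemma commutantI: "filtered \<psi> \<Longrightarrow> (\<And>\<phi>. \<phi> \<in> X \<Longrightarrow> \<psi> \<circ> \<phi> = \<phi> \<circ> \<psi>) \<Longrightarrow> \<psi> \<in> commutant X"
  and commutant_filtered: "\<psi> \<in> commutant X \<Longrightarrow> filtered \<psi>"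
  and commutant_commute: "\<psi> \<in> commutant X \<Longrightarrow> \<phi> \<in> X \<Longrightarrow> \<psi> \<circ> \<phi> = \<phi> \<circ> \<psi>"
  unfolding commutant_def by blast+

lemma commutant_swap:
  assumes "X \<subseteq> commutant Y" "\<And>\<phi>. \<phi> \<in> Y \<Longrightarrow> filtered \<phi>" shows "Y \<subseteq> commutant X"
proof
  fix \<phi> assume \<phi>: "\<phi> \<in> Y"
  show "\<phi> \<in> commutant X"
    by (rule commutantI[OF assms(2)[OF \<phi>]])
      (rule commutant_commute[OF subsetD[OF assms(1)] \<phi>, symmetric])
qed

lemma commutant_antimono: "X \<subseteq> Y \<Longrightarrow> commutant Y \<subseteq> commutant X"
  unfolding commutant_def by blast

lemma commutant_comp:
  assumes "\<phi> \<in> commutant X" "\<psi> \<in> commutant X" shows "\<phi> \<circ> \<psi> \<in> commutant X"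
proof (rule commutantI)
  show "filtered (\<phi> \<circ> \<psi>)" using assms by (intro filtered_comp commutant_filtered)
  show "(\<phi> \<circ> \<psi>) \<circ> \<theta> = \<theta> \<circ> (\<phi> \<circ> \<psi>)" if "\<theta> \<in> X" for \<theta>
    using commutant_commute[OF assms(1) that] commutant_commute[OF assms(2) that]
    by (metis comp_assoc)
qed

text \<open>The bicommutant condition keeps the groups belonging to different generators commuting.\<close>

definition has_algebraic_hull :: "('n::finite fps_n \<Rightarrow> 'n fps_n) set \<Rightarrow> bool" where
  "has_algebraic_hull X \<longleftrightarrow> (\<exists>H. algebraic_diff_group H \<and> X \<subseteq> H \<and> H \<subseteq> commutant (commutant X))"

lemma algebraic_diff_group_has_algebraic_hull:
  assumes "algebraic_diff_group H" shows "has_algebraic_hull H"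
proof -
  have "H \<subseteq> commutant (commutant H)"
    by (rule commutant_swap[OF order_refl algebraic_diff_group_filtered[OF assms]])
  with assms show ?thesis unfolding has_algebraic_hull_def by blast
qed

lemma has_algebraic_hull_empty: "has_algebraic_hull {}"
proof -
  have "algebraic_diff_group (range (\<lambda>z :: complex. id :: 'n::finite fps_n \<Rightarrow> 'n fps_n))"
    by (rule algebraic_diff_group_one_parameter) (auto intro: formal_diff_id continuous_intros)
  moreover have "id \<in> commutant (commutant {})" by (simp add: commutant_def filtered_id)
  ultimately show ?thesis unfolding has_algebraic_hull_def by auto
qed

lemma has_algebraic_hull_Un:
  assumes "has_algebraic_hull X" "has_algebraic_hull Y" and XY: "X \<subseteq> commutant Y"
  shows "has_algebraic_hull (X \<union> Y)"
proof -
  obtain H where H: "algebraic_diff_group H" "X \<subseteq> H" "H \<subseteq> commutant (commutant X)"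
    using assms(1) unfolding has_algebraic_hull_def by blast
  obtain K where K: "algebraic_diff_group K" "Y \<subseteq> K" "K \<subseteq> commutant (commutant Y)"
    using assms(2) unfolding has_algebraic_hull_def by blast
  let ?HK = "{\<phi> \<circ> \<psi> | \<phi> \<psi>. \<phi> \<in> H \<and> \<psi> \<in> K}"
  have "Y \<subseteq> commutant X"
    using algebraic_diff_group_filtered[OF K(1)] K(2) by (intro commutant_swap[OF XY]) auto
  then have "H \<subseteq> commutant Y" using H(3) commutant_antimono by blast
  then have "\<phi> \<circ> \<psi> = \<psi> \<circ> \<phi>" if "\<phi> \<in> H" "\<psi> \<in> K" for \<phi> \<psi>
    using commutant_commute[of \<psi> "commutant Y" \<phi>] that K(3) by (metis subsetD)
  then have "algebraic_diff_group ?HK" by (rule algebraic_diff_group_product[OF H(1) K(1)])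
  moreover have "X \<union> Y \<subseteq> ?HK"
  proof -
    have "\<phi> = \<phi> \<circ> id" "\<phi> = id \<circ> \<phi>" for \<phi> :: "'a fps_n \<Rightarrow> 'a fps_n" by simp_all
    then show ?thesis
      using H(2) K(2) algebraic_diff_group_id[OF H(1)] algebraic_diff_group_id[OF K(1)] by blast
  qed
  moreover have "?HK \<subseteq> commutant (commutant (X \<union> Y))"
  proof -
    have "commutant (commutant X) \<subseteq> commutant (commutant (X \<union> Y))"
      "commutant (commutant Y) \<subseteq> commutant (commutant (X \<union> Y))"
      by (intro commutant_antimono; simp)+
    then show ?thesis using H(3) K(3) by (auto intro!: commutant_comp)
  qed
  ultimately show ?thesis unfolding has_algebraic_hull_def by blast
qed

lemma has_algebraic_hull_UN:
  assumes "finite I" "\<And>i. i \<in> I \<Longrightarrow> has_algebraic_hull (X i)" "(\<Union>i\<in>I. X i) \<subseteq> commutant (\<Union>i\<in>I. X i)"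
  shows "has_algebraic_hull (\<Union>i\<in>I. X i)"
  using assms
proof (induction I)
  case (insert i I)
  have "(\<Union>j\<in>I. X j) \<subseteq> commutant (\<Union>j\<in>I. X j)" and "X i \<subseteq> commutant (\<Union>j\<in>I. X j)"
    using insert.prems(2) unfolding commutant_def by blast+
  then show ?case using insert by (simp add: has_algebraic_hull_Un)
qed (simp add: has_algebraic_hull_empty)

lemma (in eigenvalue_monoid) commutant_subset_commutant_Jordan_parts:
  "commutant {F} \<subseteq> commutant (range semisimple \<union> range upow)"
proof
  fix \<psi> assume "\<psi> \<in> commutant {F}"
  then have \<psi>: "filtered \<psi>" "\<psi> \<circ> F = F \<circ> \<psi>" unfolding commutant_def by blast+
  show "\<psi> \<in> commutant (range semisimple \<union> range upow)"
  proof (rule commutantI[OF \<psi>(1)])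
    show "\<psi> \<circ> \<phi> = \<phi> \<circ> \<psi>" if "\<phi> \<in> range semisimple \<union> range upow" for \<phi>
      using that semisimple_commute[OF \<psi>] upow_commute[OF \<psi>(1) unipotent_part_commute[OF \<psi>]]
      by blast
  qed
qed

lemma has_algebraic_hull_formal_diff:
  assumes F: "F \<in> formal_diff" shows "has_algebraic_hull {F}"
proof -
  obtain d l where l: "\<And>j. j < d \<Longrightarrow> l j \<noteq> 0" and "eigenvalue_monoid F (range (eval_monom d l))"
    by (rule formal_diff_eigenvalue_monoid[OF F]) blast
  then interpret eigenvalue_monoid F "range (eval_monom d l)" by simp
  define S where "S = (\<lambda>t. semisimple (eval_char d l t)) ` character_torus d l"
  have S: "algebraic_diff_group S" unfolding S_def by (rule algebraic_diff_group_characters) simp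
  have S_upow: "S \<union> range upow \<subseteq> range semisimple \<union> range upow" unfolding S_def by blast
  have "semisimple \<chi> \<in> commutant {F}" for \<chi>
    using semisimple_commute[OF filt refl]
    by (intro commutantI filtered_semisimple) (metis singletonD)
  then have "S \<subseteq> commutant (range upow)"
    using commutant_subset_commutant_Jordan_parts
      commutant_antimono[of "range upow" "range semisimple \<union> range upow"]
    unfolding S_def by blast
  then obtain H where H: "algebraic_diff_group H" "S \<union> range upow \<subseteq> H"
    "H \<subseteq> commutant (commutant (S \<union> range upow))"
    using has_algebraic_hull_Un algebraic_diff_group_has_algebraic_hull S algebraic_diff_group_upow
    unfolding has_algebraic_hull_def by metis
  have "commutant {F} \<subseteq> commutant (S \<union> range upow)"
    using commutant_subset_commutant_Jordan_parts commutant_antimono[OF S_upow] by blast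
  then have "H \<subseteq> commutant (commutant {F})" using H(3) commutant_antimono by blast
  moreover have "F \<in> H"
  proof -
    have "l \<in> character_torus d l" using l by (simp add: character_torus_def)
    then have "semisimple (eval_char d l l) \<in> S" "semisimple (eval_char d l l) = semisimple (\<lambda>\<mu>. \<mu>)"
      unfolding S_def by (auto intro!: semisimple_cong simp: eval_char_eval_monom)
    then have "semisimple (\<lambda>\<mu>. \<mu>) \<in> H" "unipotent_part \<in> H"
      using H(2) rangeI[of upow 1] by (auto simp: upow_1)
    then show ?thesis using algebraic_diff_group_comp[OF H(1)] semisimple_unipotent_part by metis
  qed
  ultimately show ?thesis using H(1) unfolding has_algebraic_hull_def by blast
qed

section \<open>Homomorphisms from \<open>\<int>\<^sup>p \<times> \<real>\<^sup>q\<close>\<close>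

definition int_axis :: "nat \<Rightarrow> int \<Rightarrow> (nat \<Rightarrow> int) \<times> (nat \<Rightarrow> real)" where
  "int_axis i n = ((\<lambda>j. if j = i then n else 0), (\<lambda>_. 0))"

definition real_axis :: "nat \<Rightarrow> real \<Rightarrow> (nat \<Rightarrow> int) \<times> (nat \<Rightarrow> real)" where
  "real_axis j s = ((\<lambda>_. 0), (\<lambda>k. if k = j then s else 0))"

lemma int_axis_dom: "i < p \<Longrightarrow> int_axis i n \<in> ZR_dom p q"
  and real_axis_dom: "j < q \<Longrightarrow> real_axis j s \<in> ZR_dom p q"
  by (auto simp: int_axis_def real_axis_def ZR_dom_def)

lemma int_axis_add: "ZR_add (int_axis i m) (int_axis i n) = int_axis i (m + n)"
  and real_axis_add: "ZR_add (real_axis j s) (real_axis j t) = real_axis j (s + t)"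
  by (auto simp: int_axis_def real_axis_def ZR_add_def)

definition ZR_generators :: "nat \<Rightarrow> nat \<Rightarrow> ((nat \<Rightarrow> int) \<times> (nat \<Rightarrow> real)) set" where
  "ZR_generators p q = {int_axis i 1 | i. i < p} \<union> {real_axis j s | j s. j < q}"

lemma ZR_dom_induct [consumes 1, case_names zero int_axis real_axis add]:
  assumes "x \<in> ZR_dom p q" and zero: "P ((\<lambda>_. 0), (\<lambda>_. 0))"
    and int: "\<And>i n. i < p \<Longrightarrow> P (int_axis i n)" and real: "\<And>j s. j < q \<Longrightarrow> P (real_axis j s)"
    and add: "\<And>x y. x \<in> ZR_dom p q \<Longrightarrow> y \<in> ZR_dom p q \<Longrightarrow> P x \<Longrightarrow> P y \<Longrightarrow> P (ZR_add x y)"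
  shows "P x"
proof -
  obtain a b where x: "x = (a, b)" "\<forall>i\<ge>p. a i = 0" "\<forall>j\<ge>q. b j = 0"
    using assms(1) by (auto simp: ZR_dom_def)
  have real_part: "P ((\<lambda>_. 0), (\<lambda>j. if j < k then b j else 0))" if "k \<le> q" for k
    using that
  proof (induction k)
    case (Suc k)
    let ?y = "((\<lambda>_. 0), (\<lambda>j. if j < k then b j else 0))"
    have "?y \<in> ZR_dom p q" using Suc.prems by (auto simp: ZR_dom_def)
    then have "P (ZR_add (real_axis k (b k)) ?y)" using Suc by (intro add real real_axis_dom) auto
    also have "ZR_add (real_axis k (b k)) ?y = ((\<lambda>_. 0), (\<lambda>j. if j < Suc k then b j else 0))"
      by (auto simp: ZR_add_def real_axis_def less_Suc_eq)
    finally show ?case .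
  qed (simp add: zero)
  have b: "(\<lambda>j. if j < q then b j else 0) = b" using x(3) by auto
  have "P ((\<lambda>j. if j < k then a j else 0), b)" if "k \<le> p" for k
    using that
  proof (induction k)
    case (Suc k)
    let ?y = "((\<lambda>j. if j < k then a j else 0), b)"
    have "?y \<in> ZR_dom p q" using x(3) Suc.prems by (auto simp: ZR_dom_def)
    then have "P (ZR_add (int_axis k (a k)) ?y)" using Suc by (intro add int int_axis_dom) auto
    also have "ZR_add (int_axis k (a k)) ?y = ((\<lambda>j. if j < Suc k then a j else 0), b)"
      by (auto simp: ZR_add_def int_axis_def less_Suc_eq)
    finally show ?case .
  qed (use real_part[of q] in \<open>simp add: b\<close>)
  moreover have "(\<lambda>j. if j < p then a j else 0) = a" using x(2) by auto
  ultimately show ?thesis using x(1) by force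
qed

context
  fixes p q :: nat and \<rho> :: "(nat \<Rightarrow> int) \<times> (nat \<Rightarrow> real) \<Rightarrow> 'n::finite fps_n \<Rightarrow> 'n fps_n"
  assumes \<rho>: "lie_hom_ZR p q \<rho>"
begin

lemma lie_hom_ZR_formal_diff: "x \<in> ZR_dom p q \<Longrightarrow> \<rho> x \<in> formal_diff"
  and lie_hom_ZR_add: "x \<in> ZR_dom p q \<Longrightarrow> y \<in> ZR_dom p q \<Longrightarrow> \<rho> (ZR_add x y) = \<rho> x \<circ> \<rho> y"
  using \<rho> by (auto simp: lie_hom_ZR_def)

lemma lie_hom_ZR_continuous: "ZR_continuous p q (\<lambda>x. jet_entry (\<rho> x) \<alpha> \<beta>)"
  using \<rho> unfolding lie_hom_ZR_def by (meson max.cobounded1 max.cobounded2)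

lemma lie_hom_ZR_image_commutant: "\<rho> ` ZR_dom p q \<subseteq> commutant (\<rho> ` ZR_dom p q)"
proof -
  have "\<rho> x \<circ> \<rho> y = \<rho> y \<circ> \<rho> x" if "x \<in> ZR_dom p q" "y \<in> ZR_dom p q" for x y
  proof -
    have "ZR_add x y = ZR_add y x" by (simp add: ZR_add_def add.commute)
    then show ?thesis using lie_hom_ZR_add that by metis
  qed
  then show ?thesis
    using lie_hom_ZR_formal_diff formal_diff_filtered by (blast intro: commutantI)
qed

lemma lie_hom_ZR_zero: "\<rho> ((\<lambda>_. 0), (\<lambda>_. 0)) = id"
proof -
  let ?o = "((\<lambda>_. 0), (\<lambda>_. 0)) :: (nat \<Rightarrow> int) \<times> (nat \<Rightarrow> real)"
  have dom: "?o \<in> ZR_dom p q" by (simp add: ZR_dom_def)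
  have "ZR_add ?o ?o = ?o" by (simp add: ZR_add_def)
  then have "\<rho> ?o (\<rho> ?o f) = \<rho> ?o f" for f using lie_hom_ZR_add[OF dom dom] by (metis comp_apply)
  moreover have "inj (\<rho> ?o)"
    using lie_hom_ZR_formal_diff[OF dom] formal_diff_bij bij_is_inj by blast
  ultimately show ?thesis by (metis eq_id_iff inj_eq)
qed

lemma lie_hom_ZR_int_axis_mem:
  assumes H: "algebraic_diff_group H" "\<rho> (int_axis i 1) \<in> H" and i: "i < p"
  shows "\<rho> (int_axis i n) \<in> H"
proof -
  note hom = lie_hom_ZR_add[OF int_axis_dom[OF i] int_axis_dom[OF i], unfolded int_axis_add]
  have zero: "\<rho> (int_axis i 0) = id"
    using lie_hom_ZR_zero by (simp add: int_axis_def cong: if_cong)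
  have neg: "\<rho> (int_axis i (- 1)) \<in> H"
    by (rule algebraic_diff_group_inverse[OF H]) (simp add: zero flip: hom)
  show ?thesis
  proof (induction n rule: int_induct[where k = 0])
    case base
    show ?case by (simp only: zero algebraic_diff_group_id[OF H(1)])
  next
    case (step1 n)
    then show ?case by (simp only: hom algebraic_diff_group_comp[OF H(1)] H(2))
  next
    case (step2 n)
    have "\<rho> (int_axis i (n - 1)) = \<rho> (int_axis i n) \<circ> \<rho> (int_axis i (- 1))" by (simp flip: hom)
    then show ?case using algebraic_diff_group_comp[OF H(1) step2.IH neg] by (simp only:)
  qed
qed

lemma algebraic_diff_group_real_axis:
  assumes j: "j < q" shows "algebraic_diff_group (range (\<lambda>s. \<rho> (real_axis j s)))"
proof -
  define g where "g = (\<lambda>z. \<rho> (real_axis j (Re z)))"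
  have "algebraic_diff_group (range g)"
  proof (rule algebraic_diff_group_one_parameter)
    show "g z \<in> formal_diff" for z unfolding g_def by (intro lie_hom_ZR_formal_diff real_axis_dom j)
    show "g (z + w) = g z \<circ> g w" for z w
      using lie_hom_ZR_add[OF real_axis_dom[OF j] real_axis_dom[OF j]]
      by (simp add: g_def real_axis_add)
    show "continuous_on UNIV (\<lambda>z. jet_entry (g z) \<alpha> \<beta>)" for \<alpha> \<beta>
      unfolding continuous_on_def tendsto_iff eventually_at
    proof (intro ballI allI impI)
      fix z :: complex and \<epsilon> :: real assume "\<epsilon> > 0"
      then obtain \<delta> where "\<delta> > 0" and \<delta>: "\<forall>y\<in>ZR_dom p q. fst y = fst (real_axis j (Re z)) \<and>
          (\<forall>k<q. \<bar>snd y k - snd (real_axis j (Re z)) k\<bar> < \<delta>) \<longrightarrow>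
          cmod (jet_entry (\<rho> y) \<alpha> \<beta> - jet_entry (g z) \<alpha> \<beta>) < \<epsilon>"
        using lie_hom_ZR_continuous[of \<alpha> \<beta>] real_axis_dom[OF j]
        unfolding ZR_continuous_def g_def by blast
      have "dist (jet_entry (g w) \<alpha> \<beta>) (jet_entry (g z) \<alpha> \<beta>) < \<epsilon>" if "dist w z < \<delta>" for w
      proof -
        have "\<bar>Re w - Re z\<bar> < \<delta>"
          using that abs_Re_le_cmod[of "w - z"] by (simp add: dist_norm)
        then show ?thesis
          using \<delta>[rule_format, OF real_axis_dom[OF j, of "Re w"]] \<open>\<delta> > 0\<close>
          by (simp add: real_axis_def g_def dist_norm)
      qed
      with \<open>\<delta> > 0\<close> show "\<exists>\<delta>>0. \<forall>w\<in>UNIV. w \<noteq> z \<and> dist w z < \<delta> \<longrightarrow>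
          dist (jet_entry (g w) \<alpha> \<beta>) (jet_entry (g z) \<alpha> \<beta>) < \<epsilon>" by blast
    qed
  qed
  also have "range g = range (\<lambda>s. \<rho> (real_axis j s))"
    unfolding g_def by (auto intro!: image_eqI[of _ _ "complex_of_real _"])
  finally show ?thesis .
qed

lemma has_algebraic_hull_ZR_generators: "has_algebraic_hull (\<rho> ` ZR_generators p q)"
proof -
  define X where "X = (\<Union>i<p. {\<rho> (int_axis i 1)})"
  define Y where "Y = (\<Union>j<q. range (\<lambda>s. \<rho> (real_axis j s)))"
  have "X \<union> Y \<subseteq> \<rho> ` ZR_dom p q"
    unfolding X_def Y_def using int_axis_dom real_axis_dom by blast
  then have commute: "A \<subseteq> commutant B" if "A \<subseteq> X \<union> Y" "B \<subseteq> X \<union> Y" for A B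
    using lie_hom_ZR_image_commutant commutant_antimono that by (meson order_trans)
  have "has_algebraic_hull X"
    unfolding X_def
    using int_axis_dom lie_hom_ZR_formal_diff
    by (intro has_algebraic_hull_UN has_algebraic_hull_formal_diff commute) (auto simp: X_def)
  moreover have "has_algebraic_hull Y"
    unfolding Y_def
    by (intro has_algebraic_hull_UN algebraic_diff_group_has_algebraic_hull
        algebraic_diff_group_real_axis commute) (auto simp: Y_def)
  ultimately have "has_algebraic_hull (X \<union> Y)" by (intro has_algebraic_hull_Un commute) auto
  also have "X \<union> Y = \<rho> ` ZR_generators p q"
    unfolding X_def Y_def ZR_generators_def by blast
  finally show ?thesis .
qed

lemma lie_hom_ZR_image_subset:
  assumes H: "algebraic_diff_group H" "\<rho> ` ZR_generators p q \<subseteq> H"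
  shows "\<rho> ` ZR_dom p q \<subseteq> H"
proof (rule image_subsetI)
  fix x assume "x \<in> ZR_dom p q"
  then show "\<rho> x \<in> H"
  proof (induction rule: ZR_dom_induct)
    case zero
    show ?case by (simp only: lie_hom_ZR_zero algebraic_diff_group_id[OF H(1)])
  next
    case (int_axis i n)
    then have "\<rho> (int_axis i 1) \<in> H" using H(2) unfolding ZR_generators_def by blast
    then show ?case by (rule lie_hom_ZR_int_axis_mem[OF H(1) _ int_axis])
  next
    case (real_axis j s)
    then show ?case using H(2) unfolding ZR_generators_def by blast
  next
    case (add x y)
    then show ?case by (simp only: lie_hom_ZR_add algebraic_diff_group_comp[OF H(1)])
  qed
qed

end

theorem theorem2p6:
  fixes p q :: nat
    and \<rho> :: "(nat \<Rightarrow> int) \<times> (nat \<Rightarrow> real) \<Rightarrow> ('n::finite fps_n \<Rightarrow> 'n fps_n)"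
  assumes "lie_hom_ZR p q \<rho>"
  shows "\<exists>N G (\<rho>' :: complex mat \<Rightarrow> ('n fps_n \<Rightarrow> 'n fps_n)).
           abelian_linear_algebraic_group N G \<and> lie_hom_mat N G \<rho>'
           \<and> \<rho> ` ZR_dom p q \<subseteq> \<rho>' ` G"
proof -
  have "has_algebraic_hull (\<rho> ` ZR_generators p q)"
    by (rule has_algebraic_hull_ZR_generators[OF assms])
  then obtain H where H: "algebraic_diff_group H" "\<rho> ` ZR_generators p q \<subseteq> H"
    unfolding has_algebraic_hull_def by blast
  then have "\<rho> ` ZR_dom p q \<subseteq> H" by (rule lie_hom_ZR_image_subset[OF assms])
  moreover obtain N G \<rho>'
    where "abelian_linear_algebraic_group N G" "lie_hom_mat N G \<rho>'" "\<rho>' ` G = H"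
    using H(1) by (rule algebraic_diff_groupE)
  ultimately show ?thesis by blast
qed

end
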